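(* (1) If $\kappa$ is an uncountable successor cardinal, then $\mathrm{onto}(J^{\mathrm{bd}}[\kappa],\theta)$ holds for every infinite regular cardinal $\theta<\kappa$, and $\mathrm{stick}(\kappa)$ implies $\mathrm{onto}(J^{\mathrm{bd}}[\kappa],\kappa)$. (2) Let $\kappa$ be regular uncountable. For every stationary $S\subseteq\kappa$ there exists a stationary $S'\subseteq S$ such that $\mathrm{onto}(\mathrm{NS}_\kappa\restriction S',\theta)$ holds for every infinite regular cardinal $\theta<\kappa$. (3) Let $\kappa$ be regular uncountable. If $\diamondsuit^*(\kappa)$ holds, then so does $\mathrm{onto}(\mathrm{NS}_\kappa,\kappa)$. (4) Let $\kappa$ be regular uncountable. If $\diamondsuit(T)$ holds for some stationary $T\subseteq\kappa$ that does not reflect at regulars, then $\mathrm{onto}(J^{\mathrm{bd}}[\kappa],\kappa)$ holds.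
   Context: Colourings $c:[\kappa]^2\to\theta$ are defined on pairs $(\alpha,\beta)$ with $\alpha<\beta<\kappa$; $A\circledast B:=\{(\alpha,\beta)\in A\times B\mid\alpha<\beta\}$. For an ideal $J$ over $\kappa$, $J^+:=\mathcal P(\kappa)\setminus J$. $J^{\mathrm{bd}}[\kappa]$ is the ideal of bounded subsets of $\kappa$, $\mathrm{NS}_\kappa$ the nonstationary ideal, and $\mathrm{NS}_\kappa\restriction S:=\mathrm{NS}_\kappa\cap\mathcal P(S)$ regarded as an ideal over $S$ (positive sets: stationary subsets of $S$). $\mathrm{onto}(J,\theta)$ asserts the existence of a colouring $c:[\kappa]^2\to\theta$ such that for every $B\in J^+$ there is $\eta<\kappa$ with $c[\{\eta\}\circledast B]=\theta$. For $\kappa=\mu^+$, $\mathrm{stick}(\kappa)$ asserts the existence of a family $\mathcal X\subseteq[\kappa]^{\mu}$ with $|\mathcal X|=\kappa$ such that every $B\in[\kappa]^\kappa$ has a subset belonging to $\mathcal X$. $\diamondsuit^*(S)$ asserts the existence of $\langle\mathcal A_\beta\mid\beta\in S\rangle$ with each $\mathcal A_\beta\subseteq\mathcal P(\beta)$ of size $\le|\beta|$, such that for every $A\subseteq\kappa$ there is a club $C\subseteq\kappa$ with $A\cap\beta\in\mathcal A_\beta$ for all $\beta\in C\cap S$; $\diamondsuit^*(\kappa)$ means $\diamondsuit^*(\kappa)$ with $S=\kappa$. $\diamondsuit(T)$ asserts the existence of $\langle A_\beta\mid\beta\in T\rangle$ with $A_\beta\subseteq\beta$ such that for every $A\subseteq\kappa$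 the set $\{\beta\in T\mid A\cap\beta=A_\beta\}$ is stationary. $T$ does not reflect at regulars if there is no regular uncountable $\alpha<\kappa$ with $T\cap\alpha$ stationary in $\alpha$. *)

theory Defs
  imports "HOL-Library.Countable_Set" "HOL-Library.FuncSet"
begin

unbundle cardinal_syntax

text \<open>
  Ordinals are the elements of an arbitrary type of class \<open>wellorder\<close>; following von Neumann, an
  ordinal \<open>\<kappa>\<close> is identified with the set \<open>{..<\<kappa>}\<close> of its predecessors. Every ordinal is an element
  of some such type, and with \<open>\<kappa>\<close> all ordinals below \<open>\<kappa>\<close> belong to the same type. The relation
  \<open>ordr \<kappa>\<close> is the well-order of \<open>{..<\<kappa>}\<close>, to which the library's cardinal notions are applied.
\<close>

definition ordr :: "'a::wellorder \<Rightarrow> 'a rel" where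
  "ordr \<kappa> = {(\<alpha>, \<beta>). \<alpha> \<le> \<beta> \<and> \<beta> < \<kappa>}"

lemma Field_ordr [simp]: "Field (ordr \<kappa>) = {..<\<kappa>}"
  by (auto simp: ordr_def Field_def)

lemma Well_order_ordr: "Well_order (ordr \<kappa>)"
proof -
  have "wf (ordr \<kappa> - Id)"
    by (rule wf_subset[OF wf]) (auto simp: ordr_def)
  moreover have "Linear_order (ordr \<kappa>)"
    unfolding linear_order_on_def partial_order_on_def preorder_on_def
    by (auto simp: ordr_def refl_on_def trans_def antisym_def total_on_def Field_def)
  ultimately show ?thesis
    by (simp add: well_order_on_def)
qed

definition infinite_regular :: "'a::wellorder \<Rightarrow> bool" where
  "infinite_regular \<theta> \<longleftrightarrow> Cinfinite (ordr \<theta>) \<and> regularCard (ordr \<theta>)"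

definition regular_uncountable :: "'a::wellorder \<Rightarrow> bool" where
  "regular_uncountable \<kappa> \<longleftrightarrow> infinite_regular \<kappa> \<and> uncountable {..<\<kappa>}"

definition succ_cardinal_of :: "'a::wellorder \<Rightarrow> 'a \<Rightarrow> bool" where
  "succ_cardinal_of \<mu> \<kappa> \<longleftrightarrow> Card_order (ordr \<mu>) \<and> ordr \<kappa> =o cardSuc (ordr \<mu>)"

definition uncountable_succ_cardinal :: "'a::wellorder \<Rightarrow> bool" where
  "uncountable_succ_cardinal \<kappa> \<longleftrightarrow> (\<exists>\<mu>. succ_cardinal_of \<mu> \<kappa>) \<and> uncountable {..<\<kappa>}"

text \<open>The set of all subsets of \<open>\<kappa>\<close> of cardinality \<open>\<mu>\<close>.\<close>

definition subsets_of_card :: "'a::wellorder \<Rightarrow> 'a \<Rightarrow> 'a set set" where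
  "subsets_of_card \<kappa> \<mu> = {X. X \<subseteq> {..<\<kappa>} \<and> |X| =o ordr \<mu>}"

definition bounded_in :: "'a::wellorder \<Rightarrow> 'a set \<Rightarrow> bool" where
  "bounded_in \<kappa> A \<longleftrightarrow> (\<exists>\<alpha><\<kappa>. \<forall>\<beta>\<in>A. \<beta> < \<alpha>)"

text \<open>
  Closedness refers to the \<open>\<delta> < \<kappa>\<close> with \<open>sup (C \<inter> \<delta>) = \<delta> > 0\<close>; nonemptiness of \<open>C \<inter> \<delta>\<close> excludes \<open>\<delta> = 0\<close>.
\<close>

definition club_in :: "'a::wellorder \<Rightarrow> 'a set \<Rightarrow> bool" where
  "club_in \<kappa> C \<longleftrightarrow>
     C \<subseteq> {..<\<kappa>} \<and> (\<forall>\<alpha><\<kappa>. \<exists>\<beta>\<in>C. \<alpha> < \<beta>) \<and>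
     (\<forall>\<delta><\<kappa>. C \<inter> {..<\<delta>} \<noteq> {} \<and> (\<forall>\<alpha><\<delta>. \<exists>\<beta>\<in>C \<inter> {..<\<delta>}. \<alpha> < \<beta>) \<longrightarrow> \<delta> \<in> C)"

definition stationary_in :: "'a::wellorder \<Rightarrow> 'a set \<Rightarrow> bool" where
  "stationary_in \<kappa> S \<longleftrightarrow> S \<subseteq> {..<\<kappa>} \<and> (\<forall>C. club_in \<kappa> C \<longrightarrow> S \<inter> C \<noteq> {})"

definition J_bd :: "'a::wellorder \<Rightarrow> 'a set set" where
  "J_bd \<kappa> = {A. A \<subseteq> {..<\<kappa>} \<and> bounded_in \<kappa> A}"

definition NS :: "'a::wellorder \<Rightarrow> 'a set set" where
  "NS \<kappa> = {A. A \<subseteq> {..<\<kappa>} \<and> \<not> stationary_in \<kappa> A}"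

definition NS_restr :: "'a::wellorder \<Rightarrow> 'a set \<Rightarrow> 'a set set" where
  "NS_restr \<kappa> S = NS \<kappa> \<inter> Pow S"

text \<open>The positive sets of \<open>J\<close>, an ideal over \<open>X\<close>.\<close>

definition positive :: "'a set \<Rightarrow> 'a set set \<Rightarrow> 'a set set" where
  "positive X J = Pow X - J"

lemma positive_NS_restr:
  "S \<subseteq> {..<\<kappa>} \<Longrightarrow> positive S (NS_restr \<kappa> S) = {B. B \<subseteq> S \<and> stationary_in \<kappa> B}"
  by (auto simp: positive_def NS_restr_def NS_def)

definition upairs :: "'a::wellorder set \<Rightarrow> 'a set \<Rightarrow> ('a \<times> 'a) set"  (infixr "\<circledast>" 80) where
  "A \<circledast> B = {(\<alpha>, \<beta>) \<in> A \<times> B. \<alpha> < \<beta>}"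

text \<open>
  The principle \<open>onto(J, \<theta>)\<close> for an ideal \<open>J\<close> over \<open>X \<subseteq> \<kappa>\<close>; the colouring is always defined on all
  pairs from \<open>\<kappa>\<close>, and \<open>\<eta>\<close> ranges over \<open>\<kappa>\<close>.
\<close>

definition onto :: "'a::wellorder \<Rightarrow> 'a set \<Rightarrow> 'a set set \<Rightarrow> 'a \<Rightarrow> bool" where
  "onto \<kappa> X J \<theta> \<longleftrightarrow>
     (\<exists>c \<in> {..<\<kappa>} \<circledast> {..<\<kappa>} \<rightarrow> {..<\<theta>}.
        \<forall>B \<in> positive X J. \<exists>\<eta><\<kappa>. c ` ({\<eta>} \<circledast> B) = {..<\<theta>})"

definition stick :: "'a::wellorder \<Rightarrow> bool" where
  "stick \<kappa> \<longleftrightarrow>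
     (\<exists>\<mu>. succ_cardinal_of \<mu> \<kappa> \<and>
       (\<exists>\<X> \<subseteq> subsets_of_card \<kappa> \<mu>. |\<X>| =o ordr \<kappa> \<and>
         (\<forall>B \<in> subsets_of_card \<kappa> \<kappa>. \<exists>X\<in>\<X>. X \<subseteq> B)))"

definition diamond_star :: "'a::wellorder \<Rightarrow> 'a set \<Rightarrow> bool" where
  "diamond_star \<kappa> S \<longleftrightarrow>
     (\<exists>\<A> :: 'a \<Rightarrow> 'a set set.
        (\<forall>\<beta>\<in>S. \<A> \<beta> \<subseteq> Pow {..<\<beta>} \<and> |\<A> \<beta>| \<le>o |{..<\<beta>}| ) \<and>
        (\<forall>A \<subseteq> {..<\<kappa>}. \<exists>C. club_in \<kappa> C \<and> (\<forall>\<beta> \<in> C \<inter> S. A \<inter> {..<\<beta>} \<in> \<A> \<beta>)))"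

definition diamond :: "'a::wellorder \<Rightarrow> 'a set \<Rightarrow> bool" where
  "diamond \<kappa> T \<longleftrightarrow>
     (\<exists>D :: 'a \<Rightarrow> 'a set.
        (\<forall>\<beta>\<in>T. D \<beta> \<subseteq> {..<\<beta>}) \<and>
        (\<forall>A \<subseteq> {..<\<kappa>}. stationary_in \<kappa> {\<beta>\<in>T. A \<inter> {..<\<beta>} = D \<beta>}))"

definition reflects_at_regulars :: "'a::wellorder \<Rightarrow> 'a set \<Rightarrow> bool" where
  "reflects_at_regulars \<kappa> T \<longleftrightarrow>
     (\<exists>\<alpha><\<kappa>. regular_uncountable \<alpha> \<and> stationary_in \<alpha> (T \<inter> {..<\<alpha>}))"

end

theory Submission
  imports Defs
begin

text \<open>
  A colouring \<open>c\<close> fails to be onto for \<open>B\<close> iff some \<open>g : \<kappa> \<rightarrow> \<theta>\<close> satisfies \<open>c \<eta> \<beta> \<noteq> g \<eta>\<close> for all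
  \<open>\<eta> < \<beta>\<close> with \<open>\<beta> \<in> B\<close>. So the functions \<open>c _ \<beta>\<close> have to be chosen so that every \<open>g\<close> is hit by
  \<open>c _ \<beta>\<close> for almost all \<open>\<beta>\<close>, and by coding the argument \<open>\<eta>\<close> may carry finitely many ordinals.

  For \<open>\<kappa> = \<mu>\<^sup>+\<close> with \<open>\<mu>\<close> regular, let \<open>e \<beta> : \<beta> \<rightarrow> \<mu>\<close> be injections and let \<open>h : \<kappa> \<rightarrow> \<mu>\<close> have
  fibres that are stationary in cofinality \<open>\<mu>\<close>. Colour \<open>((\<alpha>, \<zeta>), \<beta>)\<close> by \<open>h \<xi>\<close> for the least
  \<open>\<xi> \<ge> \<alpha>\<close> with \<open>e \<beta> \<xi> \<le> e \<beta> \<zeta>\<close>. By pigeonhole there are a colour \<open>j\<close> and \<open>\<kappa>\<close> many \<open>\<zeta>\<close> such that \<open>g\<close>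
  takes the value \<open>j\<close> at \<open>\<kappa>\<close> many pairs \<open>(\<alpha>, \<zeta>)\<close>; a \<open>\<delta>\<close> with \<open>h \<delta> = j\<close> that is closed enough is
  then reached from suitable \<open>\<alpha>, \<zeta> < \<delta>\<close>, for every \<open>\<beta> > \<delta>\<close>. Smaller \<open>\<theta>\<close> are reduced to this case
  for \<open>\<theta>\<^sup>+\<close> by means of ladders of length \<open>\<theta>\<^sup>+\<close>. Under the guessing principles, the guesses
  available at \<open>\<beta>\<close> are partial functions, and they are all met by assigning to each of them its own
  \<open>\<eta>\<close> in its domain. For \<open>\<diamondsuit>(T)\<close> this requires an injective regressive function on \<open>T \<inter> \<beta>\<close>, which
  exists because \<open>T\<close> does not reflect at regulars.
\<close>

section \<open>Cardinality, boundedness and regularity of initial segments\<close>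

lemma underS_ordr: "\<alpha> < \<kappa> \<Longrightarrow> underS (ordr \<kappa>) \<alpha> = {..<\<alpha>}"
  by (auto simp: underS_def ordr_def)

text \<open>The restriction of \<open>ordr \<kappa>\<close> to the predecessors of \<open>a\<close>
  is \<open>ordr a\<close>, so being a cardinal order amounts to having no proper initial segment as
  large as the whole.\<close>

lemma Card_order_ordr_iff:
  "Card_order (ordr \<kappa>) \<longleftrightarrow> (\<forall>\<alpha><\<kappa>. |{..<\<alpha>}| <o |{..<\<kappa>}| )"
proof
  assume c: "Card_order (ordr \<kappa>)"
  then have "|{..<\<kappa>}| =o ordr \<kappa>"
    using card_of_Field_ordIso by fastforce
  then show "\<forall>\<alpha><\<kappa>. |{..<\<alpha>}| <o |{..<\<kappa>}|"
    using card_of_underS[OF c] underS_ordr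
    by (metis Field_ordr lessThan_iff ordIso_symmetric ordLess_ordIso_trans)
next
  assume *: "\<forall>\<alpha><\<kappa>. |{..<\<alpha>}| <o |{..<\<kappa>}|"
  show "Card_order (ordr \<kappa>)"
    unfolding Card_order_iff_Restr_underS[OF Well_order_ordr]
  proof
    fix a assume "a \<in> Field (ordr \<kappa>)"
    then have a: "a < \<kappa>" by simp
    have R: "Restr (ordr \<kappa>) (underS (ordr \<kappa>) a) = ordr a"
      unfolding underS_ordr[OF a] using a by (auto simp: ordr_def)
    have "\<not> |{..<\<kappa>}| \<le>o ordr a"
    proof
      assume "|{..<\<kappa>}| \<le>o ordr a"
      from card_of_mono2[OF this] have "|{..<\<kappa>}| \<le>o |{..<a}|"
        by (simp add: Field_card_of)
      then show False using * a not_ordLess_ordLeq by blast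
    qed
    then show "Restr (ordr \<kappa>) (underS (ordr \<kappa>) a) <o |Field (ordr \<kappa>)|"
      unfolding R Field_ordr
      by (meson Well_order_ordr card_of_Well_order not_ordLeq_iff_ordLess)
  qed
qed

lemma card_of_lessThan_mono: "(\<alpha>::'a::wellorder) \<le> \<beta> \<Longrightarrow> |{..<\<alpha>}| \<le>o |{..<\<beta>}|"
  by (intro card_of_mono1) auto

text \<open>Replaces the order relations by initial segments and bounded sets, the form in which
  regularity is applied below. The strict inequality in \<open>cofinal\<close> matches unboundedness
  because an infinite cardinal has no largest element.\<close>

lemma infinite_regular_iff:
  "infinite_regular \<kappa> \<longleftrightarrow> infinite {..<\<kappa>} \<and> (\<forall>\<alpha><\<kappa>. |{..<\<alpha>}| <o |{..<\<kappa>}| ) \<and>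
     (\<forall>A\<subseteq>{..<\<kappa>}. |A| <o |{..<\<kappa>}| \<longrightarrow> bounded_in \<kappa> A)"
proof -
  have "regularCard (ordr \<kappa>) \<longleftrightarrow> (\<forall>A\<subseteq>{..<\<kappa>}. |A| <o |{..<\<kappa>}| \<longrightarrow> bounded_in \<kappa> A)"
    if inf: "infinite {..<\<kappa>}" and c: "Card_order (ordr \<kappa>)"
  proof -
    have iso: "|{..<\<kappa>}| =o ordr \<kappa>"
      using c card_of_Field_ordIso by fastforce
    have lim: "\<exists>b<\<kappa>. a < b" if "a < \<kappa>" for a
      using infinite_Card_order_limit[OF c, unfolded Field_ordr, OF inf, of a] that
      by (force simp: ordr_def)
    have cof: "cofinal A (ordr \<kappa>) \<longleftrightarrow> \<not> bounded_in \<kappa> A" if "A \<subseteq> {..<\<kappa>}" for A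
    proof
      assume "cofinal A (ordr \<kappa>)"
      then have "\<exists>x\<in>A. a < x" if "a < \<kappa>" for a
        unfolding cofinal_def Field_ordr using that by (auto simp: ordr_def order.strict_iff_order)
      then show "\<not> bounded_in \<kappa> A" unfolding bounded_in_def by (meson less_asym)
    next
      assume nb: "\<not> bounded_in \<kappa> A"
      show "cofinal A (ordr \<kappa>)"
        unfolding cofinal_def
      proof
        fix a assume "a \<in> Field (ordr \<kappa>)"
        then obtain b where b: "b < \<kappa>" "a < b" using lim by auto
        then obtain x where "x \<in> A" "b \<le> x" using nb unfolding bounded_in_def by (meson not_less)
        then show "\<exists>b\<in>A. a \<noteq> b \<and> (a, b) \<in> ordr \<kappa>"
          using b that by (intro bexI[of _ x]) (auto simp: ordr_def)
      qed
    qed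
    have "|A| =o ordr \<kappa> \<longleftrightarrow> \<not> |A| <o |{..<\<kappa>}|" if "A \<subseteq> {..<\<kappa>}" for A
      using that iso card_of_mono1[OF that]
      by (meson not_ordLess_ordIso ordIso_symmetric ordIso_transitive ordLeq_iff_ordLess_or_ordIso)
    then show ?thesis
      unfolding regularCard_def Field_ordr using cof by blast
  qed
  then have "(infinite {..<\<kappa>} \<and> Card_order (ordr \<kappa>)) \<and> regularCard (ordr \<kappa>) \<longleftrightarrow>
      infinite {..<\<kappa>} \<and> Card_order (ordr \<kappa>) \<and>
        (\<forall>A\<subseteq>{..<\<kappa>}. |A| <o |{..<\<kappa>}| \<longrightarrow> bounded_in \<kappa> A)"
    by (simp cong: conj_cong)
  then show ?thesis
    unfolding infinite_regular_def cinfinite_def unfolding Card_order_ordr_iff unfolding Field_ordr .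
qed

lemma infinite_regularD:
  assumes "infinite_regular \<kappa>"
  shows "infinite {..<\<kappa>}" "\<alpha> < \<kappa> \<Longrightarrow> |{..<\<alpha>}| <o |{..<\<kappa>}|"
    "A \<subseteq> {..<\<kappa>} \<Longrightarrow> |A| <o |{..<\<kappa>}| \<Longrightarrow> bounded_in \<kappa> A"
  using assms unfolding infinite_regular_iff by auto

lemma finite_card_less_infinite: "finite A \<Longrightarrow> infinite B \<Longrightarrow> |A| <o |B|"
  by (rule finite_ordLess_infinite[OF card_of_Well_order card_of_Well_order]) (simp_all add: Field_card_of)

lemma infinite_regular_limit:
  assumes "infinite_regular \<kappa>" "\<alpha> < \<kappa>"
  obtains \<beta> where "\<alpha> < \<beta>" "\<beta> < \<kappa>"
proof -
  have "bounded_in \<kappa> {\<alpha>}"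
    using infinite_regularD(1)[OF assms(1)] assms(2)
    by (intro infinite_regularD(3)[OF assms(1)]) (simp_all add: finite_card_less_infinite)
  then show ?thesis using that unfolding bounded_in_def by blast
qed

lemma bounded_image:
  assumes "infinite_regular \<kappa>" "|A| <o |{..<\<kappa>}|" "f ` A \<subseteq> {..<\<kappa>}"
  shows "\<exists>\<alpha><\<kappa>. \<forall>x\<in>A. f x < \<alpha>"
proof -
  have "|f ` A| <o |{..<\<kappa>}|"
    by (rule ordLeq_ordLess_trans[OF card_of_image assms(2)])
  from infinite_regularD(3)[OF assms(1) assms(3) this] show ?thesis
    unfolding bounded_in_def by blast
qed

lemma unbounded_iff:
  assumes "infinite_regular \<kappa>"
  shows "\<not> bounded_in \<kappa> A \<longleftrightarrow> (\<forall>\<alpha><\<kappa>. \<exists>x\<in>A. \<alpha> < x)"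
proof
  assume nb: "\<not> bounded_in \<kappa> A"
  show "\<forall>\<alpha><\<kappa>. \<exists>x\<in>A. \<alpha> < x"
  proof (intro allI impI)
    fix \<alpha> assume \<alpha>: "\<alpha> < \<kappa>"
    obtain \<beta> where \<beta>: "\<alpha> < \<beta>" "\<beta> < \<kappa>" by (rule infinite_regular_limit[OF assms \<alpha>])
    then obtain x where "x \<in> A" "\<beta> \<le> x" using nb unfolding bounded_in_def by (metis not_less)
    then show "\<exists>x\<in>A. \<alpha> < x" using \<beta>(1) by (auto intro: less_le_trans)
  qed
next
  assume "\<forall>\<alpha><\<kappa>. \<exists>x\<in>A. \<alpha> < x"
  then show "\<not> bounded_in \<kappa> A" unfolding bounded_in_def by (meson less_asym)
qed

text \<open>If every fibre had a bound below \<kappa>, regularity would bound these fewer than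
  \<kappa> bounds, and with them all of \<open>X\<close>.\<close>

lemma pigeonhole_unbounded:
  assumes "infinite_regular \<kappa>" "|I| <o |{..<\<kappa>}|" "\<not> bounded_in \<kappa> X" "f ` X \<subseteq> I" 
  shows "\<exists>i\<in>I. \<not> bounded_in \<kappa> {x\<in>X. f x = i}"
proof (rule ccontr)
  assume "\<not> ?thesis"
  then have "\<forall>i\<in>I. \<exists>\<alpha><\<kappa>. \<forall>x\<in>X. f x = i \<longrightarrow> x < \<alpha>"
    unfolding bounded_in_def by blast
  then obtain b where b: "\<forall>i\<in>I. b i < \<kappa> \<and> (\<forall>x\<in>X. f x = i \<longrightarrow> x < b i)" by metis
  then obtain \<alpha> where "\<alpha> < \<kappa>" "\<forall>i\<in>I. b i < \<alpha>"
    using bounded_image[OF assms(1,2), of b] by (auto simp: image_subset_iff)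
  then have "x < \<alpha>" if "x \<in> X" for x
    using b assms(4) that less_trans[of x "b (f x)" \<alpha>] by blast
  then show False using assms(3) \<open>\<alpha> < \<kappa>\<close> by (auto simp: bounded_in_def)
qed

lemma card_of_atMost_less:
  assumes "infinite_regular \<kappa>" "\<alpha> < \<kappa>"
  shows "|{..\<alpha>}| <o |{..<\<kappa>}|"
proof -
  obtain \<beta> where "\<alpha> < \<beta>" "\<beta> < \<kappa>" using infinite_regular_limit[OF assms] .
  then show ?thesis
    using infinite_regularD(2)[OF assms(1), of \<beta>] card_of_mono1[of "{..\<alpha>}" "{..<\<beta>}"] ordLeq_ordLess_trans
    by fastforce
qed

lemma regular_uncountable_regular: "regular_uncountable \<kappa> \<Longrightarrow> infinite_regular \<kappa>"
  by (simp add: regular_uncountable_def)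

lemma regular_uncountable_nat_bound:
  assumes "regular_uncountable \<kappa>" "\<forall>n::nat. a n < \<kappa>"
  shows "\<exists>\<alpha><\<kappa>. \<forall>n. a n < \<alpha>"
proof -
  have "\<not> |{..<\<kappa>}| \<le>o |UNIV::nat set|"
  proof
    assume "|{..<\<kappa>}| \<le>o |UNIV::nat set|"
    then obtain f :: "'a \<Rightarrow> nat" where "inj_on f {..<\<kappa>}"
      unfolding card_of_ordLeq[symmetric] by blast
    then show False using assms(1) unfolding regular_uncountable_def by (auto intro: countableI)
  qed
  then have "|UNIV::nat set| <o |{..<\<kappa>}|"
    using not_ordLeq_iff_ordLess[OF card_of_Well_order card_of_Well_order] by blast
  then show ?thesis
    using bounded_image[OF regular_uncountable_regular[OF assms(1)], of UNIV a] assms(2) by auto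
qed

lemma infinite_regular_nonempty:
  assumes "infinite_regular \<theta>" obtains i where "i < \<theta>"
  using infinite_regularD(1)[OF assms] by (metis finite.emptyI lessThan_iff all_not_in_conv)

lemma unbounded_lessThan: "\<not> bounded_in \<kappa> {..<\<kappa>}"
  unfolding bounded_in_def by auto

lemma card_of_Times3_less:
  assumes "|A| <o |C|" "infinite C"
  shows "|A \<times> A \<times> A| <o |C|"
proof (cases "finite A")
  case True
  then show ?thesis
    using assms(2) by (simp add: finite_card_less_infinite)
next
  case False
  have "|A \<times> A| =o |A|" by (rule card_of_Times_same_infinite[OF False])
  then have "|A \<times> A \<times> A| =o |A|"
    using False by (intro card_of_Times_infinite_simps(1)) (auto dest: ordIso_imp_ordLeq)
  then show ?thesis using assms(1) ordIso_ordLess_trans by blast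
qed

section \<open>Clubs of closure points and reflection at stationary sets\<close>

definition closed_under :: "('a \<Rightarrow> 'a \<Rightarrow> 'a \<Rightarrow> 'a) \<Rightarrow> 'a::wellorder \<Rightarrow> bool" where
  "closed_under f \<delta> \<longleftrightarrow> (\<forall>x<\<delta>. \<forall>y<\<delta>. \<forall>z<\<delta>. f x y z < \<delta>)"

text \<open>Closing off \<omega> times: the term \<open>a (n + 1)\<close> exceeds all values of
  \<open>f\<close> at arguments up to \<open>a n\<close>, and the supremum of the sequence stays
  below \<kappa> since countable subsets of \<kappa> are bounded.\<close>

lemma club_in_closed_under:
  assumes \<kappa>: "regular_uncountable \<kappa>" and f: "\<forall>x<\<kappa>. \<forall>y<\<kappa>. \<forall>z<\<kappa>. f x y z < \<kappa>"
    and ne: "\<gamma> < \<kappa>"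
  shows "club_in \<kappa> {\<delta>. \<delta> < \<kappa> \<and> \<gamma> < \<delta> \<and> closed_under f \<delta>}"
proof -
  note reg = regular_uncountable_regular[OF \<kappa>]
  have step: "\<exists>\<beta><\<kappa>. \<alpha> < \<beta> \<and> (\<forall>x\<le>\<alpha>. \<forall>y\<le>\<alpha>. \<forall>z\<le>\<alpha>. f x y z < \<beta>)" if \<alpha>: "\<alpha> < \<kappa>" for \<alpha>
  proof -
    let ?A = "{..\<alpha>} \<times> {..\<alpha>} \<times> {..\<alpha>}"
    have s: "|{..\<alpha>}| <o |{..<\<kappa>}|" by (rule card_of_atMost_less[OF reg \<alpha>])
    have "|?A| <o |{..<\<kappa>}|"
      by (rule card_of_Times3_less[OF s infinite_regularD(1)[OF reg]])
    then obtain b where b: "b < \<kappa>" "\<forall>p\<in>?A. (\<lambda>(x,y,z). f x y z) p < b"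
      using bounded_image[OF reg, of ?A "\<lambda>(x,y,z). f x y z"] f \<alpha>
      by (fastforce simp: image_subset_iff)
    obtain b' where "\<alpha> < b'" "b' < \<kappa>" using infinite_regular_limit[OF reg \<alpha>] .
    then show ?thesis
      using b by (intro exI[of _ "max b b'"]) (auto simp: less_max_iff_disj)
  qed
  have unb: "\<exists>\<delta>\<in>{\<delta>. \<delta> < \<kappa> \<and> \<gamma> < \<delta> \<and> closed_under f \<delta>}. \<alpha> < \<delta>" if \<alpha>: "\<alpha> < \<kappa>" for \<alpha>
  proof -
    obtain g where g: "\<And>a. a < \<kappa> \<Longrightarrow> g a < \<kappa> \<and> a < g a \<and> (\<forall>x\<le>a. \<forall>y\<le>a. \<forall>z\<le>a. f x y z < g a)"
      using step by metis
    define a where "a n = (g ^^ n) (max \<alpha> \<gamma>)" for n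
    have a: "a n < \<kappa>" for n
      by (induction n) (auto simp: a_def \<alpha> ne g)
    have aS: "a (Suc n) = g (a n)" for n by (simp add: a_def)
    then have a_less: "a n < a (Suc n)" for n using g a by simp
    then have mono: "m \<le> n \<Longrightarrow> a m \<le> a n" for m n
      by (simp add: lift_Suc_mono_le less_imp_le)
    define \<delta> where "\<delta> = (LEAST d. \<forall>n. a n < d)"
    obtain d where d: "d < \<kappa>" "\<forall>n. a n < d"
      using regular_uncountable_nat_bound[OF \<kappa>, of a] a by blast
    have \<delta>1: "\<forall>n. a n < \<delta>" unfolding \<delta>_def using d(2) by (rule LeastI)
    have "\<delta> \<le> d" unfolding \<delta>_def using d(2) by (rule Least_le)
    then have \<delta>\<kappa>: "\<delta> < \<kappa>" using d by simp
    have below: "\<exists>n. x \<le> a n" if "x < \<delta>" for x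
      using not_less_Least[OF that[unfolded \<delta>_def]] by (meson not_less)
    have "closed_under f \<delta>"
      unfolding closed_under_def
    proof (intro allI impI)
      fix x y z assume "x < \<delta>" "y < \<delta>" "z < \<delta>"
      then obtain i j k where "x \<le> a i" "y \<le> a j" "z \<le> a k" using below by meson
      then have "x \<le> a (i+j+k)" "y \<le> a (i+j+k)" "z \<le> a (i+j+k)"
        using mono[of i "i+j+k"] mono[of j "i+j+k"] mono[of k "i+j+k"] by auto
      then have "f x y z < a (Suc (i+j+k))" unfolding aS using g a by blast
      then show "f x y z < \<delta>" using \<delta>1 by (meson order_less_trans)
    qed
    moreover have "\<alpha> < \<delta>" "\<gamma> < \<delta>" using \<delta>1[rule_format, of 0] by (auto simp: a_def)
    ultimately show ?thesis using \<delta>\<kappa> by blast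
  qed
  show ?thesis
    unfolding club_in_def
  proof (intro conjI allI impI)
    fix \<delta> assume "\<delta> < \<kappa>" and *: "{\<delta>. \<delta> < \<kappa> \<and> \<gamma> < \<delta> \<and> closed_under f \<delta>} \<inter> {..<\<delta>} \<noteq> {} \<and>
      (\<forall>\<alpha><\<delta>. \<exists>\<beta>\<in>{\<delta>. \<delta> < \<kappa> \<and> \<gamma> < \<delta> \<and> closed_under f \<delta>} \<inter> {..<\<delta>}. \<alpha> < \<beta>)"
    have "closed_under f \<delta>"
      unfolding closed_under_def
    proof (intro allI impI)
      fix x y z assume "x < \<delta>" "y < \<delta>" "z < \<delta>"
      then have "max x (max y z) < \<delta>" by simp
      then obtain \<beta> where "closed_under f \<beta>" "\<beta> < \<delta>" "max x (max y z) < \<beta>" using * by blast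
      then show "f x y z < \<delta>" unfolding closed_under_def by (meson max_less_iff_conj order_less_trans)
    qed
    then show "\<delta> \<in> {\<delta>. \<delta> < \<kappa> \<and> \<gamma> < \<delta> \<and> closed_under f \<delta>}" using * \<open>\<delta> < \<kappa>\<close> by auto
  qed (use unb in auto)
qed

text \<open>Tails and diagonal intersections of clubs are absorbed into the closure function.\<close>
lemma stationary_reflect:
  assumes \<kappa>: "regular_uncountable \<kappa>" and S: "stationary_in \<kappa> S" and \<gamma>: "\<gamma> < \<kappa>"
    and f: "\<forall>x<\<kappa>. \<forall>y<\<kappa>. \<forall>z<\<kappa>. f x y z < \<kappa>"
    and D: "\<forall>x<\<kappa>. \<forall>y<\<kappa>. club_in \<kappa> (D x y)"
  obtains \<delta> where "\<delta> \<in> S" "\<delta> < \<kappa>" "\<gamma> < \<delta>" "\<forall>x<\<delta>. \<exists>y<\<delta>. x < y" "closed_under f \<delta>" "\<forall>x<\<delta>. \<forall>y<\<delta>. \<delta> \<in> D x y"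
proof -
  have "\<forall>x<\<kappa>. \<forall>y<\<kappa>. \<forall>z<\<kappa>. \<exists>d. d \<in> D x y \<and> z < d"
    using D unfolding club_in_def by blast
  \<comment> \<open>Closure under \<open>n\<close> makes \<delta> a limit of \<open>D x y\<close>
    for all \<open>x\<close> and \<open>y\<close> below \<delta>, so that \<delta> enters the
    diagonal intersection.\<close>
  then obtain n where n: "\<forall>x<\<kappa>. \<forall>y<\<kappa>. \<forall>z<\<kappa>. n x y z \<in> D x y \<and> z < n x y z" by metis
  then have n\<kappa>: "\<forall>x<\<kappa>. \<forall>y<\<kappa>. \<forall>z<\<kappa>. n x y z < \<kappa>" using D unfolding club_in_def by blast
  define h where "h x y z = max (f x y z) (n x y z)" for x y z
  have "club_in \<kappa> {\<delta>. \<delta> < \<kappa> \<and> \<gamma> < \<delta> \<and> closed_under h \<delta>}"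
    using f n\<kappa> by (intro club_in_closed_under \<kappa> \<gamma>) (auto simp: h_def)
  then obtain \<delta> where \<delta>: "\<delta> \<in> S" "\<delta> < \<kappa>" "\<gamma> < \<delta>" "closed_under h \<delta>"
    using S unfolding stationary_in_def by blast
  then have cf: "closed_under f \<delta>" and cn: "\<forall>x<\<delta>. \<forall>y<\<delta>. \<forall>z<\<delta>. n x y z < \<delta>"
    by (auto simp: closed_under_def h_def)
  have nD: "n x y z \<in> D x y \<and> z < n x y z \<and> n x y z < \<delta>" if "x < \<delta>" "y < \<delta>" "z < \<delta>" for x y z
    using that cn n \<delta> by (meson order_less_trans)
  have "\<delta> \<in> D x y" if xy: "x < \<delta>" "y < \<delta>" for x y
  proof -
    have "club_in \<kappa> (D x y)" using D xy \<delta> by (meson order_less_trans)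
    moreover have "D x y \<inter> {..<\<delta>} \<noteq> {}" using nD[OF xy xy(1)] by auto
    moreover have "\<forall>\<alpha><\<delta>. \<exists>\<beta>\<in>D x y \<inter> {..<\<delta>}. \<alpha> < \<beta>" using nD[OF xy] by blast
    ultimately show ?thesis using \<delta> unfolding club_in_def by blast
  qed
  then show ?thesis using that \<delta> cf nD by blast
qed

lemma club_UNIV: "infinite_regular \<kappa> \<Longrightarrow> club_in \<kappa> {..<\<kappa>}"
  unfolding club_in_def using infinite_regular_limit by (metis Int_iff lessThan_iff order_refl)

section \<open>Ladders and cofinality\<close>

text \<open>For regular \<open>\<nu>\<close> this says that \<open>\<delta>\<close> has cofinality at least \<open>\<nu>\<close>.\<close>
definition cof_ge :: "'a::wellorder \<Rightarrow> 'a \<Rightarrow> bool" where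
  "cof_ge \<nu> \<delta> \<longleftrightarrow> (\<forall>A\<subseteq>{..<\<delta>}. |A| <o |{..<\<nu>}| \<longrightarrow> bounded_in \<delta> A)"

text \<open>A ladder of length \<nu> converging to \<delta>. It need not be continuous, so its terms
  can be taken from any prescribed unbounded set.\<close>

definition cofinal_seq :: "'a::wellorder \<Rightarrow> ('a \<Rightarrow> 'a) \<Rightarrow> 'a \<Rightarrow> bool" where
  "cofinal_seq \<nu> s \<delta> \<longleftrightarrow> (\<forall>i<\<nu>. \<forall>j<i. s j < s i) \<and> (\<forall>i<\<nu>. s i < \<delta>) \<and> (\<forall>x<\<delta>. \<exists>i<\<nu>. x < s i)"

text \<open>The ladder is built by recursion inside \<open>X\<close>: regularity of \<kappa> bounds
  the terms chosen so far, and \<delta> is the supremum of all of them.\<close>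

lemma exists_cofinal_seq:
  assumes \<kappa>: "infinite_regular \<kappa>" and X: "X \<subseteq> {..<\<kappa>}" "\<not> bounded_in \<kappa> X"
    and \<nu>: "\<nu> < \<kappa>" "infinite_regular \<nu>"
  obtains s \<delta> where "\<delta> < \<kappa>" "cofinal_seq \<nu> s \<delta>" "\<forall>i<\<nu>. s i \<in> X"
proof -
  have small: "|{..<i}| <o |{..<\<kappa>}|" if "i \<le> \<nu>" for i
    using infinite_regularD(2)[OF \<kappa>] that \<nu> by auto
  have "\<exists>s. \<forall>i. i < \<nu> \<longrightarrow> s i \<in> X \<and> (\<forall>j<i. s j < s i)"
  proof (rule dependent_wellorder_choice)
    fix i and s :: "'a \<Rightarrow> 'a"
    assume IH: "\<And>j. j < i \<Longrightarrow> j < \<nu> \<longrightarrow> s j \<in> X \<and> (\<forall>k<j. s k < s j)"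
    show "\<exists>r. i < \<nu> \<longrightarrow> r \<in> X \<and> (\<forall>j<i. s j < r)"
    proof (cases "i < \<nu>")
      case True
      then have "s ` {..<i} \<subseteq> {..<\<kappa>}" using IH X(1) by (auto dest: order_less_trans)
      then obtain \<alpha> where "\<alpha> < \<kappa>" "\<forall>j\<in>{..<i}. s j < \<alpha>"
        using bounded_image[OF \<kappa> small, of i s] True by (metis less_imp_le)
      then show ?thesis using X(2) unfolding unbounded_iff[OF \<kappa>] by (meson lessThan_iff order_less_trans)
    qed auto
  qed auto
  then obtain s where s: "\<forall>i<\<nu>. s i \<in> X \<and> (\<forall>j<i. s j < s i)" by blast
  then have "s ` {..<\<nu>} \<subseteq> {..<\<kappa>}" using X by auto
  then obtain \<alpha> where \<alpha>: "\<alpha> < \<kappa>" "\<forall>j\<in>{..<\<nu>}. s j < \<alpha>"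
    using bounded_image[OF \<kappa> small, of \<nu> s] by blast
  define \<delta> where "\<delta> = (LEAST d. \<forall>j\<in>{..<\<nu>}. s j < d)"
  have 1: "\<forall>j\<in>{..<\<nu>}. s j < \<delta>" unfolding \<delta>_def using \<alpha>(2) by (rule LeastI)
  have "\<delta> \<le> \<alpha>" unfolding \<delta>_def using \<alpha>(2) by (rule Least_le)
  have below: "\<exists>i<\<nu>. x < s i" if x: "x < \<delta>" for x
  proof -
    obtain j where j: "j < \<nu>" "x \<le> s j"
      using not_less_Least[OF x[unfolded \<delta>_def]] by (meson lessThan_iff not_less)
    \<comment> \<open>Minimality of \<delta> only gives \<open>x \<le> s j\<close>; as \<nu> has no
      largest element, a later term lies strictly above \<open>x\<close>.\<close>
    obtain i where "j < i" "i < \<nu>" by (rule infinite_regular_limit[OF \<nu>(2) j(1)])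
    then show ?thesis using j s by (meson order_le_less_trans)
  qed
  have "cofinal_seq \<nu> s \<delta>" unfolding cofinal_seq_def using s 1 below by auto
  then show ?thesis using that[of \<delta> s] \<open>\<delta> \<le> \<alpha>\<close> \<alpha> s by auto
qed

lemma cofinal_seq_cof_ge:
  assumes \<nu>: "infinite_regular \<nu>" and s: "cofinal_seq \<nu> s \<delta>"
  shows "cof_ge \<nu> \<delta>"
  unfolding cof_ge_def
proof (intro allI impI)
  fix A assume A: "A \<subseteq> {..<\<delta>}" "|A| <o |{..<\<nu>}|"
  then have "\<forall>x\<in>A. \<exists>i<\<nu>. x < s i" using s by (auto simp: cofinal_seq_def)
  then obtain i where i: "\<forall>x\<in>A. i x < \<nu> \<and> x < s (i x)" by metis
  then obtain j where "j < \<nu>" "\<forall>x\<in>A. i x < j" using bounded_image[OF \<nu> A(2), of i] by blast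
  then show "bounded_in \<delta> A"
    using s i unfolding bounded_in_def cofinal_seq_def by (meson order_less_trans)
qed

text \<open>A club contains all terms of some ladder of length \<nu>, and hence its limit.\<close>

lemma stationary_cofinal_seq:
  assumes \<kappa>: "regular_uncountable \<kappa>" and \<nu>: "\<nu> < \<kappa>" "infinite_regular \<nu>"
  shows "stationary_in \<kappa> {\<delta>. \<delta> < \<kappa> \<and> (\<exists>s. cofinal_seq \<nu> s \<delta>)}"
  unfolding stationary_in_def
proof (intro conjI allI impI)
  note reg = regular_uncountable_regular[OF \<kappa>]
  fix C assume C: "club_in \<kappa> C"
  then have unb: "\<not> bounded_in \<kappa> C" unfolding unbounded_iff[OF reg] club_in_def by blast
  have sub: "C \<subseteq> {..<\<kappa>}" using C by (simp add: club_in_def)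
  obtain s \<delta> where s: "\<delta> < \<kappa>" "cofinal_seq \<nu> s \<delta>" "\<forall>i<\<nu>. s i \<in> C"
    by (rule exists_cofinal_seq[OF reg sub unb \<nu>])
  have "\<exists>i. i < \<nu>" using infinite_regular_nonempty[OF \<nu>(2)] by blast
  then have "C \<inter> {..<\<delta>} \<noteq> {}" "\<forall>\<alpha><\<delta>. \<exists>\<beta>\<in>C \<inter> {..<\<delta>}. \<alpha> < \<beta>"
    using s unfolding cofinal_seq_def by (auto, blast)
  then have "\<delta> \<in> C" using C s(1) unfolding club_in_def by blast
  then show "{\<delta>. \<delta> < \<kappa> \<and> (\<exists>s. cofinal_seq \<nu> s \<delta>)} \<inter> C \<noteq> {}" using s by auto
qed auto

lemma stationary_subset_mono:
  "stationary_in \<kappa> S \<Longrightarrow> S \<subseteq> S' \<Longrightarrow> S' \<subseteq> {..<\<kappa>} \<Longrightarrow> stationary_in \<kappa> S'"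
  unfolding stationary_in_def by blast

section \<open>Coding of tuples and a criterion for \<open>onto\<close>\<close>

lemma inj_pairing:
  assumes "infinite (A::'a set)"
  obtains p :: "'a \<Rightarrow> 'a \<Rightarrow> 'a" where
    "\<forall>x\<in>A. \<forall>y\<in>A. \<forall>x'\<in>A. \<forall>y'\<in>A. p x y = p x' y' \<longrightarrow> x = x' \<and> y = y'"
    "\<forall>x\<in>A. \<forall>y\<in>A. p x y \<in> A"
proof -
  have "|A \<times> A| \<le>o |A|" using card_of_Times_same_infinite[OF assms] ordIso_imp_ordLeq by blast
  then obtain f where f: "inj_on f (A \<times> A)" "f ` (A \<times> A) \<subseteq> A" unfolding card_of_ordLeq[symmetric] by blast
  show ?thesis
  proof (rule that[of "\<lambda>x y. f (x, y)"])
    show "\<forall>x\<in>A. \<forall>y\<in>A. \<forall>x'\<in>A. \<forall>y'\<in>A. f (x, y) = f (x', y') \<longrightarrow> x = x' \<and> y = y'"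
    proof (intro ballI impI)
      fix x y x' y' assume "x \<in> A" "y \<in> A" "x' \<in> A" "y' \<in> A" "f (x, y) = f (x', y')"
      then show "x = x' \<and> y = y'" using inj_onD[OF f(1), of "(x, y)" "(x', y')"] by simp
    qed
  qed (use f(2) in auto)
qed

lemma inj_tripling:
  assumes "infinite (A::'a set)"
  obtains p :: "'a \<Rightarrow> 'a \<Rightarrow> 'a \<Rightarrow> 'a" where
    "inj_on (\<lambda>(x, y, z). p x y z) (A \<times> A \<times> A)" "\<forall>x\<in>A. \<forall>y\<in>A. \<forall>z\<in>A. p x y z \<in> A"
proof -
  obtain p where p: "\<forall>x\<in>A. \<forall>y\<in>A. \<forall>x'\<in>A. \<forall>y'\<in>A. p x y = p x' y' \<longrightarrow> x = x' \<and> y = y'"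
    "\<forall>x\<in>A. \<forall>y\<in>A. p x y \<in> A"
    by (rule inj_pairing[OF assms])
  show ?thesis
  proof (rule that[of "\<lambda>x y z. p x (p y z)"])
    show "inj_on (\<lambda>(x, y, z). p x (p y z)) (A \<times> A \<times> A)"
    proof (rule inj_onI)
      fix u v assume "u \<in> A \<times> A \<times> A" "v \<in> A \<times> A \<times> A"
        and eq: "(\<lambda>(x, y, z). p x (p y z)) u = (\<lambda>(x, y, z). p x (p y z)) v"
      then obtain x y z x' y' z' where uv: "u = (x, y, z)" "v = (x', y', z')"
        and A: "x \<in> A" "y \<in> A" "z \<in> A" "x' \<in> A" "y' \<in> A" "z' \<in> A" by blast
      have "x = x' \<and> p y z = p y' z'"
        using eq uv A p(2) by (intro p(1)[rule_format]) auto
      moreover from this have "y = y' \<and> z = z'" using A by (intro p(1)[rule_format]) auto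
      ultimately show "u = v" using uv by simp
    qed
  qed (use p(2) in blast)
qed

text \<open>If every \<open>p\<close> missed some colour on \<open>B\<close>, choosing a missed
  colour for each \<open>p\<close> would give a \<open>g\<close> that contradicts
  \<open>hit\<close>. Arguments that code no element of \<open>P\<close> receive the constant colour
  \<open>\<theta>'\<close>.\<close>

lemma ontoI:
  assumes code: "inj_on code P" "code ` P \<subseteq> {..<\<kappa>}" and ne: "\<theta>' < \<theta>"
    and c: "\<And>p \<beta>. p \<in> P \<Longrightarrow> \<beta> < \<kappa> \<Longrightarrow> code p < \<beta> \<Longrightarrow> c p \<beta> < \<theta>"
    and X: "X \<subseteq> {..<\<kappa>}"
    and hit: "\<And>B g. B \<in> positive X J \<Longrightarrow> (\<forall>p\<in>P. g p < \<theta>) \<Longrightarrow> \<exists>p\<in>P. \<exists>\<beta>\<in>B. code p < \<beta> \<and> c p \<beta> = g p"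
  shows "onto \<kappa> X J \<theta>"
proof -
  define d where "d = (\<lambda>(\<eta>, \<beta>). if \<eta> \<in> code ` P then c (inv_into P code \<eta>) \<beta> else \<theta>')"
  have dc: "d (code p, \<beta>) = c p \<beta>" if "p \<in> P" for p \<beta>
    using that code by (simp add: d_def inv_into_f_f)
  have "d \<in> {..<\<kappa>} \<circledast> {..<\<kappa>} \<rightarrow> {..<\<theta>}"
  proof
    fix q assume "q \<in> {..<\<kappa>} \<circledast> {..<\<kappa>}"
    then obtain \<eta> \<beta> where "q = (\<eta>, \<beta>)" "\<eta> < \<beta>" "\<beta> < \<kappa>" by (auto simp: upairs_def)
    then show "d q \<in> {..<\<theta>}" using c ne by (cases "\<eta> \<in> code ` P") (auto simp: dc, auto simp: d_def)
  qed
  moreover have "\<exists>\<eta><\<kappa>. d ` ({\<eta>} \<circledast> B) = {..<\<theta>}" if B: "B \<in> positive X J" for B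
  proof -
    have BX: "B \<subseteq> {..<\<kappa>}" using B X by (auto simp: positive_def)
    have "\<exists>p\<in>P. \<forall>i<\<theta>. \<exists>\<beta>\<in>B. code p < \<beta> \<and> c p \<beta> = i"
    proof (rule ccontr)
      assume "\<not> ?thesis"
      then have "\<forall>p\<in>P. \<exists>i<\<theta>. \<not> (\<exists>\<beta>\<in>B. code p < \<beta> \<and> c p \<beta> = i)" by blast
      then obtain g where "\<forall>p\<in>P. g p < \<theta> \<and> \<not> (\<exists>\<beta>\<in>B. code p < \<beta> \<and> c p \<beta> = g p)" by metis
      then show False using hit[OF B, of g] by blast
    qed
    then obtain p where p: "p \<in> P" "\<forall>i<\<theta>. \<exists>\<beta>\<in>B. code p < \<beta> \<and> c p \<beta> = i" by blast
    have "d ` ({code p} \<circledast> B) = {..<\<theta>}"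
    proof
      show "d ` ({code p} \<circledast> B) \<subseteq> {..<\<theta>}"
        using BX c p(1) dc by (auto simp: upairs_def)
      show "{..<\<theta>} \<subseteq> d ` ({code p} \<circledast> B)"
      proof
        fix i assume "i \<in> {..<\<theta>}"
        then obtain \<beta> where "\<beta> \<in> B" "code p < \<beta>" "c p \<beta> = i" using p by auto
        then show "i \<in> d ` ({code p} \<circledast> B)"
          using dc[OF p(1)] by (intro image_eqI[of _ _ "(code p, \<beta>)"]) (auto simp: upairs_def)
      qed
    qed
    then show ?thesis using code p by blast
  qed
  ultimately show ?thesis unfolding onto_def by blast
qed

lemma positive_J_bd: "positive {..<\<kappa>} (J_bd \<kappa>) = {B. B \<subseteq> {..<\<kappa>} \<and> \<not> bounded_in \<kappa> B}"
  by (auto simp: positive_def J_bd_def)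

lemma onto_J_bdD:
  assumes "onto \<kappa> {..<\<kappa>} (J_bd \<kappa>) \<theta>"
  shows "\<exists>c. (\<forall>\<beta><\<kappa>. \<forall>\<eta><\<beta>. c \<eta> \<beta> < \<theta>) \<and>
    (\<forall>B\<subseteq>{..<\<kappa>}. \<not> bounded_in \<kappa> B \<longrightarrow> (\<exists>\<eta><\<kappa>. \<forall>i<\<theta>. \<exists>\<beta>\<in>B. \<eta> < \<beta> \<and> c \<eta> \<beta> = i))"
proof -
  obtain c where c: "c \<in> {..<\<kappa>} \<circledast> {..<\<kappa>} \<rightarrow> {..<\<theta>}"
    and o: "\<forall>B \<in> positive {..<\<kappa>} (J_bd \<kappa>). \<exists>\<eta><\<kappa>. c ` ({\<eta>} \<circledast> B) = {..<\<theta>}"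
    using assms unfolding onto_def by blast
  show ?thesis
  proof (intro exI[of _ "\<lambda>\<eta> \<beta>. c (\<eta>, \<beta>)"] conjI allI impI)
    fix \<eta> \<beta> assume "\<eta> < \<beta>" "\<beta> < \<kappa>"
    then show "c (\<eta>, \<beta>) < \<theta>" using c by (auto simp: upairs_def Pi_def)
  next
    fix B assume "B \<subseteq> {..<\<kappa>}" "\<not> bounded_in \<kappa> B"
    then obtain \<eta> where \<eta>: "\<eta> < \<kappa>" "c ` ({\<eta>} \<circledast> B) = {..<\<theta>}" using o unfolding positive_J_bd by blast
    have "\<exists>\<beta>\<in>B. \<eta> < \<beta> \<and> c (\<eta>, \<beta>) = i" if "i < \<theta>" for i
    proof -
      have "i \<in> c ` ({\<eta>} \<circledast> B)" using \<eta>(2) that by simp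
      then show ?thesis by (auto simp: upairs_def)
    qed
    then show "\<exists>\<eta><\<kappa>. \<forall>i<\<theta>. \<exists>\<beta>\<in>B. \<eta> < \<beta> \<and> c (\<eta>, \<beta>) = i" using \<eta>(1) by blast
  qed
qed

section \<open>Successor cardinals\<close>

lemma card_of_lessThan_ordr: "Card_order (ordr \<kappa>) \<Longrightarrow> |{..<\<kappa>}| =o ordr \<kappa>"
  using card_of_Field_ordIso[of "ordr \<kappa>"] by simp

text \<open>An infinite successor cardinal is regular, even when its predecessor \<mu> is
  singular.\<close>

lemma succ_cardinal_ofD:
  assumes s: "succ_cardinal_of \<mu> \<kappa>" and inf: "infinite {..<\<mu>}"
  shows "regular_uncountable \<kappa>" "\<mu> < \<kappa>" "\<And>\<beta>. \<beta> < \<kappa> \<Longrightarrow> |{..<\<beta>}| \<le>o |{..<\<mu>}|"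
    "\<And>\<alpha>. \<alpha> < \<mu> \<Longrightarrow> |{..<\<alpha>}| <o |{..<\<mu>}|" "|{..<\<mu>}| <o |{..<\<kappa>}|"
proof -
  have c\<mu>: "Card_order (ordr \<mu>)" and iso: "ordr \<kappa> =o cardSuc (ordr \<mu>)"
    using s by (auto simp: succ_cardinal_of_def)
  have iso\<mu>: "|{..<\<mu>}| =o ordr \<mu>" by (rule card_of_lessThan_ordr[OF c\<mu>])
  have cs: "Card_order (cardSuc (ordr \<mu>))" by (rule cardSuc_Card_order[OF c\<mu>])
  have c\<kappa>: "Card_order (ordr \<kappa>)" by (rule Card_order_ordIso[OF cs iso])
  have iso\<kappa>: "|{..<\<kappa>}| =o cardSuc (ordr \<mu>)"
    by (rule ordIso_transitive[OF card_of_lessThan_ordr[OF c\<kappa>] iso])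
  show less: "|{..<\<mu>}| <o |{..<\<kappa>}|"
    by (rule ordLess_ordIso_trans[OF ordIso_ordLess_trans[OF iso\<mu> cardSuc_greater[OF c\<mu>]]
          ordIso_symmetric[OF iso\<kappa>]])
  show "\<mu> < \<kappa>"
  proof (rule ccontr)
    assume "\<not> \<mu> < \<kappa>"
    then have "|{..<\<kappa>}| \<le>o |{..<\<mu>}|" by (intro card_of_lessThan_mono) simp
    then show False using less not_ordLess_ordLeq by blast
  qed
  show "|{..<\<beta>}| \<le>o |{..<\<mu>}|" if "\<beta> < \<kappa>" for \<beta>
  proof -
    have "|{..<\<beta>}| <o |{..<\<kappa>}|" using c\<kappa> that unfolding Card_order_ordr_iff by blast
    then have "|{..<\<beta>}| <o cardSuc (ordr \<mu>)" by (rule ordLess_ordIso_trans[OF _ iso\<kappa>])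
    then have "|{..<\<beta>}| \<le>o ordr \<mu>"
      unfolding cardSuc_ordLeq_ordLess[OF c\<mu> card_of_Card_order] .
    then show ?thesis by (rule ordLeq_ordIso_trans[OF _ ordIso_symmetric[OF iso\<mu>]])
  qed
  show "|{..<\<alpha>}| <o |{..<\<mu>}|" if "\<alpha> < \<mu>" for \<alpha>
    using c\<mu> that unfolding Card_order_ordr_iff by blast
  have C\<mu>: "Cinfinite (ordr \<mu>)" using c\<mu> inf by (simp add: cinfinite_def)
  have "regularCard (ordr \<kappa>)"
    by (rule regularCard_ordIso[OF ordIso_symmetric[OF iso] Cinfinite_cardSuc[OF C\<mu>] regularCard_cardSuc[OF C\<mu>]])
  moreover have "infinite {..<\<kappa>}"
  proof
    assume "finite {..<\<kappa>}"
    then have "finite {..<\<mu>}" by (rule finite_subset[rotated]) (use \<open>\<mu> < \<kappa>\<close> in auto)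
    then show False using inf by blast
  qed
  ultimately have ir: "infinite_regular \<kappa>"
    using c\<kappa> by (simp add: infinite_regular_def cinfinite_def)
  have "uncountable {..<\<kappa>}"
  proof
    assume "countable {..<\<kappa>}"
    then obtain f :: "'a \<Rightarrow> nat" where "inj_on f {..<\<kappa>}" unfolding countable_def by blast
    then have "|{..<\<kappa>}| \<le>o |UNIV::nat set|" by (auto simp: card_of_ordLeq[symmetric])
    also have "|UNIV::nat set| \<le>o |{..<\<mu>}|" using inf infinite_iff_card_of_nat by blast
    finally show False using less not_ordLess_ordLeq by blast
  qed
  then show "regular_uncountable \<kappa>" using ir by (simp add: regular_uncountable_def)
qed

text \<open>The successor of \<theta> is realised in the given type by the least ordinal with more
  predecessors than \<theta>. A strictly shorter \<open>cardSuc\<close> would be isomorphic to a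
  proper initial segment, and those have at most |\<theta>| elements.\<close>

lemma exists_succ_cardinal_of:
  fixes \<theta> \<kappa> :: "'a::wellorder"
  assumes c: "Card_order (ordr \<theta>)" and less: "|{..<\<theta>}| <o |{..<\<kappa>}|"
  obtains l where "l \<le> \<kappa>" "succ_cardinal_of \<theta> l"
proof -
  define l :: 'a where "l = (LEAST x. |{..<\<theta>}| <o |{..<x}| )"
  have ll: "|{..<\<theta>}| <o |{..<l}|" unfolding l_def by (rule LeastI[of _ \<kappa>]) (rule less)
  have lk: "l \<le> \<kappa>" unfolding l_def by (rule Least_le) (rule less)
  have below: "|{..<a}| \<le>o |{..<\<theta>}|" if "a < l" for a
    using not_less_Least[OF that[unfolded l_def]] by (simp add: not_ordLess_iff_ordLeq[OF card_of_Well_order card_of_Well_order])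
  have cl: "Card_order (ordr l)"
    unfolding Card_order_ordr_iff using below ll ordLeq_ordLess_trans by blast
  have cs: "Card_order (cardSuc (ordr \<theta>))" by (rule cardSuc_Card_order[OF c])
  have "ordr \<theta> <o ordr l"
    using ll card_of_lessThan_ordr[OF c] card_of_lessThan_ordr[OF cl]
    by (meson ordIso_ordLess_trans ordIso_symmetric ordLess_ordIso_trans)
  then have 1: "cardSuc (ordr \<theta>) \<le>o ordr l" by (rule cardSuc_least[OF c cl])
  have "\<not> cardSuc (ordr \<theta>) <o ordr l"
  proof
    assume "cardSuc (ordr \<theta>) <o ordr l"
    then obtain a where a: "a < l" and iso: "cardSuc (ordr \<theta>) =o Restr (ordr l) (underS (ordr l) a)"
      using ordLess_iff_ordIso_Restr[OF Well_order_ordr cardSuc_Well_order[OF c]] by auto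
    have R: "Restr (ordr l) (underS (ordr l) a) = ordr a"
      unfolding underS_ordr[OF a] using a by (auto simp: ordr_def)
    have "|Field (cardSuc (ordr \<theta>))| =o |{..<a}|"
      using card_of_cong[OF iso[unfolded R]] by simp
    then have "cardSuc (ordr \<theta>) =o |{..<a}|"
      using card_of_Field_ordIso[OF cs] ordIso_symmetric ordIso_transitive by blast
    then have "cardSuc (ordr \<theta>) \<le>o |{..<\<theta>}|" using below[OF a] ordIso_ordLeq_trans by blast
    then have "cardSuc (ordr \<theta>) \<le>o ordr \<theta>" using card_of_lessThan_ordr[OF c] ordLeq_ordIso_trans by blast
    then show False using cardSuc_greater[OF c] not_ordLess_ordLeq by blast
  qed
  then have "ordr l =o cardSuc (ordr \<theta>)"
    using 1 ordIso_symmetric ordLeq_iff_ordLess_or_ordIso by blast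
  then show ?thesis using that lk c by (simp add: succ_cardinal_of_def)
qed

lemma inj_family_below:
  assumes "\<And>\<beta>. \<beta> < \<kappa> \<Longrightarrow> |{..<\<beta>}| \<le>o |{..<\<mu>}|"
  obtains e where "\<forall>\<beta><\<kappa>. inj_on (e \<beta>) {..<\<beta>}" "\<forall>\<beta><\<kappa>. \<forall>\<xi><\<beta>. e \<beta> \<xi> < (\<mu>::'a::wellorder)"
proof -
  have "\<forall>\<beta>. \<exists>f. \<beta> < \<kappa> \<longrightarrow> inj_on f {..<\<beta>} \<and> f ` {..<\<beta>} \<subseteq> {..<\<mu>}"
    using assms unfolding card_of_ordLeq[symmetric] by blast
  then obtain e where "\<forall>\<beta>. \<beta> < \<kappa> \<longrightarrow> inj_on (e \<beta>) {..<\<beta>} \<and> e \<beta> ` {..<\<beta>} \<subseteq> {..<\<mu>}" by metis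
  then show ?thesis using that[of e] by blast
qed

text \<open>Supplies \<mu> many members of \<open>X\<close> below one \<gamma>, so that a single
  \<delta> can be placed above all of them.\<close>

lemma unbounded_has_small_copy:
  assumes \<kappa>: "infinite_regular \<kappa>" and X: "X \<subseteq> {..<\<kappa>}" "\<not> bounded_in \<kappa> X" and \<mu>: "\<mu> < \<kappa>" "infinite_regular \<mu>"
  obtains \<gamma> s where "\<gamma> < \<kappa>" "inj_on s {..<\<mu>}" "\<forall>i<\<mu>. s i \<in> X \<and> s i < \<gamma>"
proof -
  obtain s \<delta> where s: "\<delta> < \<kappa>" "cofinal_seq \<mu> s \<delta>" "\<forall>i<\<mu>. s i \<in> X"
    by (rule exists_cofinal_seq[OF \<kappa> X \<mu>])
  have "inj_on s {..<\<mu>}"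
  proof (rule linorder_inj_onI)
    fix x y assume "x < y" "x \<in> {..<\<mu>}" "y \<in> {..<\<mu>}"
    then show "s x \<noteq> s y" using s(2) by (force simp: cofinal_seq_def)
  qed auto
  then show ?thesis using that s by (auto simp: cofinal_seq_def)
qed

section \<open>A successor of a regular cardinal, with the predecessor as set of colours\<close>

text \<open>The cells \<open>U \<rho> i\<close> form an Ulam matrix. Were the stationary cells of
  each \<rho> bounded in \<mu>, then \<mu> many \<rho> would share a bound \<open>b'\<close>, and a
  \<delta> in a diagonal intersection would map all of them injectively below \<open>b'\<close> by
  \<open>e \<delta>\<close>. So some \<rho> has \<mu> many stationary cells, and these are pairwise
  disjoint.\<close>

lemma Ulam_stationary_partition:
  fixes \<kappa> :: "'a::wellorder"
  assumes s: "succ_cardinal_of \<mu> \<kappa>" and \<mu>: "infinite_regular \<mu>"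
  obtains h where "\<forall>\<delta>. h \<delta> < \<mu>" "\<forall>i<\<mu>. stationary_in \<kappa> {\<delta>. \<delta> < \<kappa> \<and> cof_ge \<mu> \<delta> \<and> h \<delta> = i}"
proof -
  note d = succ_cardinal_ofD[OF s infinite_regularD(1)[OF \<mu>]]
  note \<kappa> = d(1) and reg = regular_uncountable_regular[OF d(1)]
  obtain e where e: "\<forall>\<beta><\<kappa>. inj_on (e \<beta>) {..<\<beta>}" "\<forall>\<beta><\<kappa>. \<forall>\<xi><\<beta>. e \<beta> \<xi> < \<mu>"
    by (rule inj_family_below[OF d(3)])
  define \<Gamma> where "\<Gamma> = {\<delta>. \<delta> < \<kappa> \<and> cof_ge \<mu> \<delta>}"
  have stat\<Gamma>: "stationary_in \<kappa> \<Gamma>"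
    by (rule stationary_subset_mono[OF stationary_cofinal_seq[OF \<kappa> d(2) \<mu>]])
      (auto simp: \<Gamma>_def cofinal_seq_cof_ge[OF \<mu>])
  define U where "U \<rho> i = {\<delta>\<in>\<Gamma>. \<rho> < \<delta> \<and> e \<delta> \<rho> = i}" for \<rho> i
  define I where "I \<rho> = {i. i < \<mu> \<and> stationary_in \<kappa> (U \<rho> i)}" for \<rho>
  have "\<exists>\<rho><\<kappa>. \<not> bounded_in \<mu> (I \<rho>)"
  proof (rule ccontr)
    assume "\<not> ?thesis"
    then have "\<forall>\<rho><\<kappa>. \<exists>b<\<mu>. \<forall>i\<in>I \<rho>. i < b" by (auto simp: bounded_in_def)
    then obtain b where b: "\<forall>\<rho><\<kappa>. b \<rho> < \<mu> \<and> (\<forall>i\<in>I \<rho>. i < b \<rho>)" by metis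
    obtain b' where b': "b' < \<mu>" "\<not> bounded_in \<kappa> {\<rho>\<in>{..<\<kappa>}. b \<rho> = b'}"
      using pigeonhole_unbounded[OF reg d(5) unbounded_lessThan, of b] b by auto
    define R where "R = {\<rho>\<in>{..<\<kappa>}. b \<rho> = b'}"
    have R: "R \<subseteq> {..<\<kappa>}" "\<not> bounded_in \<kappa> R" using b' by (auto simp: R_def)
    obtain \<gamma> s where \<gamma>: "\<gamma> < \<kappa>" and s: "inj_on s {..<\<mu>}" "\<forall>i<\<mu>. s i \<in> R \<and> s i < \<gamma>"
      by (rule unbounded_has_small_copy[OF reg R d(2) \<mu>])
    \<comment> \<open>A cell known to be nonstationary is avoided by a club; for all other indices
      \<kappa> itself is taken, so that the diagonal intersection runs over all pairs.\<close>
    have "\<exists>D. club_in \<kappa> D \<and> (\<rho> \<in> R \<and> b' \<le> i \<and> i < \<mu> \<longrightarrow> D \<inter> U \<rho> i = {})" if "\<rho> < \<kappa>" "i < \<kappa>" for \<rho> i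
    proof (cases "\<rho> \<in> R \<and> b' \<le> i \<and> i < \<mu>")
      case True
      have "\<forall>k\<in>I \<rho>. k < b'" using b True by (auto simp: R_def)
      then have "i \<notin> I \<rho>" using True leD by blast
      then have "\<not> stationary_in \<kappa> (U \<rho> i)" using True by (auto simp: I_def)
      moreover have "U \<rho> i \<subseteq> {..<\<kappa>}" by (auto simp: U_def \<Gamma>_def)
      ultimately show ?thesis unfolding stationary_in_def by blast
    qed (use club_UNIV[OF reg] in blast)
    then obtain D where D: "\<forall>\<rho><\<kappa>. \<forall>i<\<kappa>. club_in \<kappa> (D \<rho> i) \<and> (\<rho> \<in> R \<and> b' \<le> i \<and> i < \<mu> \<longrightarrow> D \<rho> i \<inter> U \<rho> i = {})"
      by metis
    \<comment> \<open>Being above \<gamma> and \<mu>, \<delta> exceeds every \<open>s i\<close> and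
      every value \<open>e \<delta> (s i)\<close>; both can then serve as indices in the diagonal
      intersection.\<close>
    obtain \<delta> where \<delta>: "\<delta> \<in> \<Gamma>" "\<delta> < \<kappa>" "max \<gamma> \<mu> < \<delta>" "\<forall>x<\<delta>. \<forall>y<\<delta>. \<delta> \<in> D x y"
      by (rule stationary_reflect[OF \<kappa> stat\<Gamma>, of "max \<gamma> \<mu>" "\<lambda>x y z. x" D]) (use D \<gamma> d(2) in auto)
    have "e \<delta> (s i) < b'" if i: "i < \<mu>" for i
    proof (rule ccontr)
      assume "\<not> e \<delta> (s i) < b'"
      moreover have si: "s i < \<delta>" "s i \<in> R" using s i \<delta> by auto
      moreover have "e \<delta> (s i) < \<mu>" using e(2) \<delta>(2) si by blast
      moreover from this have "e \<delta> (s i) < \<delta>" using \<delta>(3) by auto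
      ultimately have "\<delta> \<in> D (s i) (e \<delta> (s i))" "D (s i) (e \<delta> (s i)) \<inter> U (s i) (e \<delta> (s i)) = {}"
        using \<delta> D by (auto simp: not_less)
      moreover have "\<delta> \<in> U (s i) (e \<delta> (s i))" using si \<delta> by (auto simp: U_def)
      ultimately show False by blast
    qed
    then have "(e \<delta> \<circ> s) ` {..<\<mu>} \<subseteq> {..<b'}" by auto
    moreover have "inj_on (e \<delta> \<circ> s) {..<\<mu>}"
    proof (rule comp_inj_on[OF s(1)])
      have "s ` {..<\<mu>} \<subseteq> {..<\<delta>}" using s(2) \<delta> by auto
      then show "inj_on (e \<delta>) (s ` {..<\<mu>})" using e(1) \<delta>(2) inj_on_subset by blast
    qed
    ultimately have "|{..<\<mu>}| \<le>o |{..<b'}|" unfolding card_of_ordLeq[symmetric] by blast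
    then show False using d(4)[OF b'(1)] not_ordLess_ordLeq by blast
  qed
  then obtain \<rho> where \<rho>: "\<rho> < \<kappa>" "\<not> bounded_in \<mu> (I \<rho>)" by blast
  have "\<not> |I \<rho>| <o |{..<\<mu>}|"
    using infinite_regularD(3)[OF \<mu>, of "I \<rho>"] \<rho> by (auto simp: I_def)
  then have le: "|{..<\<mu>}| \<le>o |I \<rho>|" using not_ordLess_iff_ordLeq[OF card_of_Well_order card_of_Well_order] by blast
  obtain i0 where i0: "i0 < \<mu>" by (rule infinite_regular_nonempty[OF \<mu>])
  then obtain \<phi> where \<phi>: "\<phi> ` I \<rho> = {..<\<mu>}" using le card_of_ordLeq2[of "{..<\<mu>}" "I \<rho>"] by blast
  \<comment> \<open>The map \<phi> renumbers the stationary cells of \<rho> onto \<mu>, so each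
    fibre of \<open>h\<close> contains one of them.\<close>
  define h where "h \<delta> = (if e \<delta> \<rho> \<in> I \<rho> then \<phi> (e \<delta> \<rho>) else i0)" for \<delta>
  show ?thesis
  proof (rule that[of h])
    show "\<forall>\<delta>. h \<delta> < \<mu>" using \<phi> i0 by (auto simp: h_def)
    show "\<forall>i<\<mu>. stationary_in \<kappa> {\<delta>. \<delta> < \<kappa> \<and> cof_ge \<mu> \<delta> \<and> h \<delta> = i}"
    proof (intro allI impI)
      fix i assume "i < \<mu>"
      then have "i \<in> \<phi> ` I \<rho>" using \<phi> by simp
      then obtain j where j: "j \<in> I \<rho>" "\<phi> j = i" by blast
      then have "stationary_in \<kappa> (U \<rho> j)" by (simp add: I_def)
      then show "stationary_in \<kappa> {\<delta>. \<delta> < \<kappa> \<and> cof_ge \<mu> \<delta> \<and> h \<delta> = i}"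
        by (rule stationary_subset_mono) (use j in \<open>auto simp: U_def \<Gamma>_def h_def\<close>)
    qed
  qed
qed

text \<open>The coordinate \<open>\<zeta>\<close> tunes the threshold: once \<open>e \<beta> \<zeta> \<ge> e \<beta> \<delta>\<close>, every large enough \<open>\<alpha> < \<delta>\<close>
  leads to \<open>\<xi> = \<delta>\<close>.\<close>
lemma onto_J_bd_pred:
  fixes \<kappa> :: "'a::wellorder"
  assumes s: "succ_cardinal_of \<mu> \<kappa>" and \<mu>: "infinite_regular \<mu>"
  shows "onto \<kappa> {..<\<kappa>} (J_bd \<kappa>) \<mu>"
proof -
  note d = succ_cardinal_ofD[OF s infinite_regularD(1)[OF \<mu>]]
  note \<kappa> = d(1) and reg = regular_uncountable_regular[OF d(1)]
  obtain e where e: "\<forall>\<beta><\<kappa>. inj_on (e \<beta>) {..<\<beta>}" "\<forall>\<beta><\<kappa>. \<forall>\<xi><\<beta>. e \<beta> \<xi> < \<mu>"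
    by (rule inj_family_below[OF d(3)])
  obtain h where h: "\<forall>\<delta>. h \<delta> < \<mu>" "\<forall>i<\<mu>. stationary_in \<kappa> {\<delta>. \<delta> < \<kappa> \<and> cof_ge \<mu> \<delta> \<and> h \<delta> = i}"
    by (rule Ulam_stationary_partition[OF s \<mu>])
  obtain p where p: "\<forall>x\<in>{..<\<kappa>}. \<forall>y\<in>{..<\<kappa>}. \<forall>x'\<in>{..<\<kappa>}. \<forall>y'\<in>{..<\<kappa>}. p x y = p x' y' \<longrightarrow> x = x' \<and> y = y'"
    "\<forall>x\<in>{..<\<kappa>}. \<forall>y\<in>{..<\<kappa>}. p x y \<in> {..<\<kappa>}"
    by (rule inj_pairing[OF infinite_regularD(1)[OF reg]])
  obtain i0 where i0: "i0 < \<mu>" by (rule infinite_regular_nonempty[OF \<mu>])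
  define c where "c = (\<lambda>(\<alpha>, \<zeta>) \<beta>. h (LEAST \<xi>. \<alpha> \<le> \<xi> \<and> \<xi> < \<beta> \<and> e \<beta> \<xi> \<le> e \<beta> \<zeta>))"
  show ?thesis
  proof (rule ontoI[where P = "{..<\<kappa>} \<times> {..<\<kappa>}" and code = "\<lambda>(x, y). p x y" and c = c, OF _ _ i0])
    show "inj_on (\<lambda>(x, y). p x y) ({..<\<kappa>} \<times> {..<\<kappa>})" using p(1) by (auto simp: inj_on_def)
    show "(\<lambda>(x, y). p x y) ` ({..<\<kappa>} \<times> {..<\<kappa>}) \<subseteq> {..<\<kappa>}" using p(2) by auto
    show "c q \<beta> < \<mu>" for q \<beta> using h(1) by (simp add: c_def split: prod.split)
  next
    fix B and g :: "'a \<times> 'a \<Rightarrow> 'a"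
    assume "B \<in> positive {..<\<kappa>} (J_bd \<kappa>)" and "\<forall>q\<in>{..<\<kappa>} \<times> {..<\<kappa>}. g q < \<mu>"
    then have B: "B \<subseteq> {..<\<kappa>}" "\<not> bounded_in \<kappa> B" and g: "\<forall>x<\<kappa>. \<forall>y<\<kappa>. g (x, y) < \<mu>"
      by (auto simp: positive_J_bd)
    have "\<exists>i<\<mu>. \<not> bounded_in \<kappa> {\<alpha>\<in>{..<\<kappa>}. g (\<alpha>, \<zeta>) = i}" if "\<zeta> < \<kappa>" for \<zeta>
      using pigeonhole_unbounded[OF reg d(5) unbounded_lessThan, of "\<lambda>\<alpha>. g (\<alpha>, \<zeta>)"] g that by auto
    then obtain i where i: "\<forall>\<zeta><\<kappa>. i \<zeta> < \<mu> \<and> \<not> bounded_in \<kappa> {\<alpha>\<in>{..<\<kappa>}. g (\<alpha>, \<zeta>) = i \<zeta>}" by metis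
    obtain j where j: "j < \<mu>" "\<not> bounded_in \<kappa> {\<zeta>\<in>{..<\<kappa>}. i \<zeta> = j}"
      using pigeonhole_unbounded[OF reg d(5) unbounded_lessThan, of i] i by auto
    define Z where "Z = {\<zeta>\<in>{..<\<kappa>}. i \<zeta> = j}"
    have Z: "Z \<subseteq> {..<\<kappa>}" "\<not> bounded_in \<kappa> Z" using j by (auto simp: Z_def)
    obtain \<gamma> s where \<gamma>: "\<gamma> < \<kappa>" and s: "inj_on s {..<\<mu>}" "\<forall>i<\<mu>. s i \<in> Z \<and> s i < \<gamma>"
      by (rule unbounded_has_small_copy[OF reg Z d(2) \<mu>])
    \<comment> \<open>For \<zeta> in \<open>Z\<close> this gives an argument beyond \<open>x\<close>
      where the slice of \<open>g\<close> at \<zeta> has colour \<open>j\<close>. Closure of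
      \<delta> under it will keep \<alpha> below \<delta>.\<close>
    have "\<exists>n. n < \<kappa> \<and> (\<zeta> \<in> Z \<longrightarrow> x < n \<and> g (n, \<zeta>) = j)" if "\<zeta> < \<kappa>" "x < \<kappa>" for \<zeta> x
    proof (cases "\<zeta> \<in> Z")
      case True
      then have "\<not> bounded_in \<kappa> {\<alpha>\<in>{..<\<kappa>}. g (\<alpha>, \<zeta>) = j}" using i by (auto simp: Z_def)
      then show ?thesis using that(2) unfolding unbounded_iff[OF reg] by auto
    qed (use that in auto)
    then obtain n where n: "\<forall>\<zeta><\<kappa>. \<forall>x<\<kappa>. n \<zeta> x < \<kappa> \<and> (\<zeta> \<in> Z \<longrightarrow> x < n \<zeta> x \<and> g (n \<zeta> x, \<zeta>) = j)" by metis
    obtain \<delta> where \<delta>: "\<delta> \<in> {\<delta>. \<delta> < \<kappa> \<and> cof_ge \<mu> \<delta> \<and> h \<delta> = j}" "\<gamma> < \<delta>"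
      and cl: "closed_under (\<lambda>x y z. max (n x y) (p x y)) \<delta>"
      by (rule stationary_reflect[OF \<kappa> h(2)[rule_format, OF j(1)] \<gamma>,
            of "\<lambda>x y z. max (n x y) (p x y)" "\<lambda>x y. {..<\<kappa>}"])
        (use n p(2) club_UNIV[OF reg] in auto)
    have clp: "n x y < \<delta>" "p x y < \<delta>" if "x < \<delta>" "y < \<delta>" for x y
      using cl that unfolding closed_under_def by fastforce+
    obtain \<beta> where \<beta>: "\<beta> \<in> B" "\<delta> < \<beta>" using B(2) \<delta>(1) unfolding unbounded_iff[OF reg] by blast
    have \<beta>\<kappa>: "\<beta> < \<kappa>" using B \<beta> by auto
    have injb: "inj_on (e \<beta>) {..<\<beta>}" using e(1) \<beta>\<kappa> by blast
    \<comment> \<open>Otherwise \<open>e \<beta>\<close> would inject the \<mu> many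
      \<open>s i\<close> into the fewer than \<mu> predecessors of
      \<open>e \<beta> \<delta>\<close>.\<close>
    have "\<exists>i<\<mu>. e \<beta> \<delta> \<le> e \<beta> (s i)"
    proof (rule ccontr)
      assume "\<not> ?thesis"
      then have "(e \<beta> \<circ> s) ` {..<\<mu>} \<subseteq> {..<e \<beta> \<delta>}" by auto
      moreover have "s ` {..<\<mu>} \<subseteq> {..<\<beta>}" using s(2) \<delta> \<beta> by force
      then have "inj_on (e \<beta> \<circ> s) {..<\<mu>}" by (intro comp_inj_on[OF s(1)] inj_on_subset[OF injb])
      ultimately have "|{..<\<mu>}| \<le>o |{..<e \<beta> \<delta>}|" unfolding card_of_ordLeq[symmetric] by blast
      then show False using d(4)[of "e \<beta> \<delta>"] e(2) \<beta>\<kappa> \<beta> not_ordLess_ordLeq by blast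
    qed
    then obtain \<zeta> where \<zeta>: "\<zeta> \<in> Z" "\<zeta> < \<delta>" "e \<beta> \<delta> \<le> e \<beta> \<zeta>" using s(2) \<delta>(2) by (metis less_trans)
    \<comment> \<open>The points below \<delta> that could stop the search before \<delta>.
      Injectivity of \<open>e \<beta>\<close> leaves fewer than \<mu> of them, so they are bounded
      in \<delta>, and \<alpha> is taken beyond the bound.\<close>
    define F where "F = {\<xi>. \<xi> < \<delta> \<and> e \<beta> \<xi> \<le> e \<beta> \<zeta>}"
    have "|F| <o |{..<\<mu>}|"
    proof -
      have "inj_on (e \<beta>) F" using injb by (rule inj_on_subset) (use \<beta> in \<open>auto simp: F_def\<close>)
      moreover have "e \<beta> ` F \<subseteq> {..e \<beta> \<zeta>}" by (auto simp: F_def)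
      ultimately have "|F| \<le>o |{..e \<beta> \<zeta>}|" unfolding card_of_ordLeq[symmetric] by blast
      moreover have "e \<beta> \<zeta> < \<mu>" using e(2) \<beta>\<kappa> \<zeta> \<beta> by (meson less_trans)
      ultimately show ?thesis using card_of_atMost_less[OF \<mu>] ordLeq_ordLess_trans by blast
    qed
    moreover have "F \<subseteq> {..<\<delta>}" by (auto simp: F_def)
    ultimately have "bounded_in \<delta> F" using \<delta>(1) by (simp add: cof_ge_def)
    then obtain x where x: "x < \<delta>" "\<forall>\<xi>\<in>F. \<xi> < x" unfolding bounded_in_def by blast
    define \<alpha> where "\<alpha> = n \<zeta> x"
    have \<alpha>: "\<alpha> < \<delta>" "x < \<alpha>" "g (\<alpha>, \<zeta>) = j"
      using clp(1)[OF \<zeta>(2) x(1)] n \<zeta> x(1) \<delta>(1) by (auto simp: \<alpha>_def dest: less_trans)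
    have "(LEAST \<xi>. \<alpha> \<le> \<xi> \<and> \<xi> < \<beta> \<and> e \<beta> \<xi> \<le> e \<beta> \<zeta>) = \<delta>"
    proof (rule Least_equality)
      show "\<alpha> \<le> \<delta> \<and> \<delta> < \<beta> \<and> e \<beta> \<delta> \<le> e \<beta> \<zeta>" using \<alpha> \<zeta> \<beta> by simp
      fix y assume y: "\<alpha> \<le> y \<and> y < \<beta> \<and> e \<beta> y \<le> e \<beta> \<zeta>"
      show "\<delta> \<le> y"
      proof (rule ccontr)
        assume "\<not> \<delta> \<le> y"
        then have "y \<in> F" using y by (auto simp: F_def)
        then show False using x(2) \<alpha>(2) y by fastforce
      qed
    qed
    then have "c (\<alpha>, \<zeta>) \<beta> = g (\<alpha>, \<zeta>)" using \<delta>(1) \<alpha>(3) by (simp add: c_def)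
    moreover have "p \<alpha> \<zeta> < \<beta>" using clp(2)[OF \<alpha>(1) \<zeta>(2)] \<beta> by simp
    moreover have "(\<alpha>, \<zeta>) \<in> {..<\<kappa>} \<times> {..<\<kappa>}" using \<alpha> \<zeta> \<delta>(1) by (auto dest: less_trans)
    ultimately show "\<exists>q\<in>{..<\<kappa>} \<times> {..<\<kappa>}. \<exists>\<beta>\<in>B. (\<lambda>(x, y). p x y) q < \<beta> \<and> c q \<beta> = g q"
      using \<beta>(1) by (intro bexI[of _ "(\<alpha>, \<zeta>)"] bexI[of _ \<beta>]) auto
  qed auto
qed

section \<open>Smaller sets of colours: projections along ladders\<close>

definition seq_index :: "'a::wellorder \<Rightarrow> ('a \<Rightarrow> 'a) \<Rightarrow> 'a \<Rightarrow> 'a" where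
  "seq_index \<nu> s x = (LEAST j. j < \<nu> \<and> x \<le> s j)"

lemma seq_index:
  assumes "cofinal_seq \<nu> s \<delta>" "x < \<delta>"
  shows "seq_index \<nu> s x < \<nu>" "x \<le> s (seq_index \<nu> s x)"
proof -
  obtain j where "j < \<nu>" "x < s j" using assms by (auto simp: cofinal_seq_def)
  then have "j < \<nu> \<and> x \<le> s j" by simp
  then have "seq_index \<nu> s x < \<nu> \<and> x \<le> s (seq_index \<nu> s x)"
    unfolding seq_index_def by (rule LeastI)
  then show "seq_index \<nu> s x < \<nu>" "x \<le> s (seq_index \<nu> s x)" by auto
qed

text \<open>This is what makes \<open>seq_index\<close> send subsets unbounded in \<delta> to
  subsets unbounded in \<nu>.\<close>

lemma seq_index_greater:
  assumes s: "cofinal_seq \<nu> s \<delta>" and x: "x < \<delta>" "s v < x" and v: "v < \<nu>"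
  shows "v < seq_index \<nu> s x"
proof (rule ccontr)
  assume "\<not> v < seq_index \<nu> s x"
  then have "seq_index \<nu> s x < v \<or> seq_index \<nu> s x = v" by auto
  then have "s (seq_index \<nu> s x) \<le> s v" using s v by (auto simp: cofinal_seq_def intro: less_imp_le)
  then show False using seq_index(2)[OF s x(1)] x(2) by simp
qed

text \<open>If \<open>\<theta>\<close> is not the predecessor of \<open>\<kappa>\<close>, an unbounded subset of \<open>\<kappa>\<close> is first turned into
  an unbounded subset of \<open>\<theta>\<^sup>+\<close>, by comparing it with a ladder of length \<open>\<theta>\<^sup>+\<close>.\<close>
lemma onto_projections:
  fixes \<kappa> :: "'a::wellorder"
  assumes \<kappa>: "regular_uncountable \<kappa>" and \<theta>: "infinite_regular \<theta>" "\<theta> < \<kappa>"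
  obtains p :: "'a \<Rightarrow> 'a \<Rightarrow> 'a \<Rightarrow> 'a" where "\<forall>u v x. p u v x < \<theta>"
    "\<forall>X\<subseteq>{..<\<kappa>}. \<not> bounded_in \<kappa> X \<longrightarrow> (\<exists>u<\<kappa>. \<exists>v<\<kappa>. \<forall>i<\<theta>. \<exists>x\<in>X. p u v x = i)"
proof -
  note reg = regular_uncountable_regular[OF \<kappa>]
  have c\<theta>: "Card_order (ordr \<theta>)" using \<theta>(1) by (simp add: infinite_regular_def)
  obtain l where l: "l \<le> \<kappa>" "succ_cardinal_of \<theta> l"
    by (rule exists_succ_cardinal_of[OF c\<theta> infinite_regularD(2)[OF reg \<theta>(2)]])
  note d = succ_cardinal_ofD[OF l(2) infinite_regularD(1)[OF \<theta>(1)]]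
  note regl = regular_uncountable_regular[OF d(1)]
  obtain i0 where i0: "i0 < \<theta>" by (rule infinite_regular_nonempty[OF \<theta>(1)])
  obtain c where c: "\<forall>\<beta><l. \<forall>\<eta><\<beta>. c \<eta> \<beta> < \<theta>"
    "\<forall>B\<subseteq>{..<l}. \<not> bounded_in l B \<longrightarrow> (\<exists>\<eta><l. \<forall>i<\<theta>. \<exists>\<beta>\<in>B. \<eta> < \<beta> \<and> c \<eta> \<beta> = i)"
    using onto_J_bdD[OF onto_J_bd_pred[OF l(2) \<theta>(1)]] by blast
  show ?thesis
  proof (cases "l = \<kappa>")
    case True
    define p where "p u v x = (if v < x \<and> x < \<kappa> then c v x else i0)" for u v x :: 'a
    show ?thesis
    proof (rule that[of p])
      show "\<forall>u v x. p u v x < \<theta>" using c(1) i0 True by (auto simp: p_def)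
      show "\<forall>X\<subseteq>{..<\<kappa>}. \<not> bounded_in \<kappa> X \<longrightarrow> (\<exists>u<\<kappa>. \<exists>v<\<kappa>. \<forall>i<\<theta>. \<exists>x\<in>X. p u v x = i)"
      proof (intro allI impI)
        fix X assume X: "X \<subseteq> {..<\<kappa>}" "\<not> bounded_in \<kappa> X"
        then obtain \<eta> where \<eta>: "\<eta> < \<kappa>" "\<forall>i<\<theta>. \<exists>\<beta>\<in>X. \<eta> < \<beta> \<and> c \<eta> \<beta> = i" using c(2) True by blast
        have "\<exists>x\<in>X. p \<eta> \<eta> x = i" if i: "i < \<theta>" for i
        proof -
          obtain x where "x \<in> X" "\<eta> < x" "c \<eta> x = i" using \<eta>(2) i by blast
          then show ?thesis using X(1) by (intro bexI[of _ x]) (auto simp: p_def)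
        qed
        then show "\<exists>u<\<kappa>. \<exists>v<\<kappa>. \<forall>i<\<theta>. \<exists>x\<in>X. p u v x = i" using \<eta>(1) by blast
      qed
    qed
  next
    case False
    then have l\<kappa>: "l < \<kappa>" using l by simp
    \<comment> \<open>The projections must not depend on \<open>X\<close>, so one ladder is fixed in
      advance for every \<xi> that has one. The ladder found inside \<open>X\<close> later only
      locates a suitable \<xi>.\<close>
    define \<sigma> where "\<sigma> \<xi> = (SOME s. cofinal_seq l s \<xi>)" for \<xi>
    have \<sigma>: "cofinal_seq l (\<sigma> \<xi>) \<xi>" if "cofinal_seq l s \<xi>" for s \<xi>
      unfolding \<sigma>_def by (rule someI[of "\<lambda>s. cofinal_seq l s \<xi>", OF that])
    define p where "p u v x = (if v < seq_index l (\<sigma> u) x \<and> seq_index l (\<sigma> u) x < l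
      then c v (seq_index l (\<sigma> u) x) else i0)" for u v x
    show ?thesis
    proof (rule that[of p])
      show "\<forall>u v x. p u v x < \<theta>" using c(1) i0 by (auto simp: p_def)
      show "\<forall>X\<subseteq>{..<\<kappa>}. \<not> bounded_in \<kappa> X \<longrightarrow> (\<exists>u<\<kappa>. \<exists>v<\<kappa>. \<forall>i<\<theta>. \<exists>x\<in>X. p u v x = i)"
      proof (intro allI impI)
        fix X assume X: "X \<subseteq> {..<\<kappa>}" "\<not> bounded_in \<kappa> X"
        obtain s \<xi> where s: "\<xi> < \<kappa>" "cofinal_seq l s \<xi>" "\<forall>i<l. s i \<in> X"
          by (rule exists_cofinal_seq[OF reg X l\<kappa> regl])
        note \<sigma>\<xi> = \<sigma>[OF s(2)]
        \<comment> \<open>Both \<open>X\<close> and the fixed ladder are cofinal in \<xi>, hence the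
          positions of members of \<open>X\<close> in that ladder are unbounded in
          \<open>l\<close>.\<close>
        define Y where "Y = seq_index l (\<sigma> \<xi>) ` (X \<inter> {..<\<xi>})"
        have Y: "Y \<subseteq> {..<l}" using seq_index(1)[OF \<sigma>\<xi>] by (auto simp: Y_def)
        have "\<not> bounded_in l Y"
          unfolding unbounded_iff[OF regl]
        proof (intro allI impI)
          fix v assume v: "v < l"
          then have "\<sigma> \<xi> v < \<xi>" using \<sigma>\<xi> by (simp add: cofinal_seq_def)
          then obtain i where i: "i < l" "\<sigma> \<xi> v < s i" using s(2) by (auto simp: cofinal_seq_def)
          then have si: "s i < \<xi>" "s i \<in> X" using s by (auto simp: cofinal_seq_def)
          have "v < seq_index l (\<sigma> \<xi>) (s i)" by (rule seq_index_greater[OF \<sigma>\<xi> si(1) i(2) v])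
          then show "\<exists>y\<in>Y. v < y" using si by (auto simp: Y_def)
        qed
        then obtain \<eta> where \<eta>: "\<eta> < l" "\<forall>i<\<theta>. \<exists>\<beta>\<in>Y. \<eta> < \<beta> \<and> c \<eta> \<beta> = i" using c(2) Y by blast
        have "\<exists>x\<in>X. p \<xi> \<eta> x = i" if i: "i < \<theta>" for i
        proof -
          obtain y where y: "y \<in> Y" "\<eta> < y" "c \<eta> y = i" using \<eta>(2) i by blast
          then obtain x where "x \<in> X" "y = seq_index l (\<sigma> \<xi>) x" by (auto simp: Y_def)
          then show ?thesis using y Y by (intro bexI[of _ x]) (auto simp: p_def)
        qed
        moreover have "\<eta> < \<kappa>" using \<eta>(1) l\<kappa> by simp
        ultimately show "\<exists>u<\<kappa>. \<exists>v<\<kappa>. \<forall>i<\<theta>. \<exists>x\<in>X. p u v x = i" using s(1) by blast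
      qed
    qed
  qed
qed

text \<open>Each \<open>\<beta>\<close> sees every ladder below it through the index \<open>\<epsilon> = e \<beta> \<delta>\<close>. As there are fewer than
  \<open>\<kappa>\<close> indices, a single \<open>\<delta>\<close> can be chosen to be good for the \<open>\<epsilon>\<close>-th slice of \<open>g\<close> for every \<open>\<epsilon>\<close>.\<close>
lemma onto_J_bd_less_pred:
  fixes \<kappa> :: "'a::wellorder"
  assumes s: "succ_cardinal_of \<mu> \<kappa>" and \<theta>: "infinite_regular \<theta>" "\<theta> < \<mu>"
  shows "onto \<kappa> {..<\<kappa>} (J_bd \<kappa>) \<theta>"
proof -
  have inf\<mu>: "infinite {..<\<mu>}"
  proof
    assume "finite {..<\<mu>}"
    then have "finite {..<\<theta>}" by (rule finite_subset[rotated]) (use \<theta> in auto)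
    then show False using infinite_regularD(1)[OF \<theta>(1)] by blast
  qed
  note d = succ_cardinal_ofD[OF s inf\<mu>]
  note \<kappa> = d(1) and reg = regular_uncountable_regular[OF d(1)]
  have c\<theta>: "Card_order (ordr \<theta>)" using \<theta>(1) by (simp add: infinite_regular_def)
  obtain l where l: "l \<le> \<mu>" "succ_cardinal_of \<theta> l"
    by (rule exists_succ_cardinal_of[OF c\<theta> d(4)[OF \<theta>(2)]])
  then have l\<kappa>: "l < \<kappa>" using d(2) by simp
  note dl = succ_cardinal_ofD[OF l(2) infinite_regularD(1)[OF \<theta>(1)]]
  note regl = regular_uncountable_regular[OF dl(1)]
  obtain i0 where i0: "i0 < \<theta>" by (rule infinite_regular_nonempty[OF \<theta>(1)])
  obtain c' where c': "\<forall>\<beta><l. \<forall>\<eta><\<beta>. c' \<eta> \<beta> < \<theta>"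
    "\<forall>B\<subseteq>{..<l}. \<not> bounded_in l B \<longrightarrow> (\<exists>\<eta><l. \<forall>i<\<theta>. \<exists>\<beta>\<in>B. \<eta> < \<beta> \<and> c' \<eta> \<beta> = i)"
    using onto_J_bdD[OF onto_J_bd_pred[OF l(2) \<theta>(1)]] by blast
  obtain e where e: "\<forall>\<beta><\<kappa>. inj_on (e \<beta>) {..<\<beta>}" "\<forall>\<beta><\<kappa>. \<forall>\<xi><\<beta>. e \<beta> \<xi> < \<mu>"
    by (rule inj_family_below[OF d(3)])
  obtain p where p: "inj_on (\<lambda>(x, y, z). p x y z) ({..<\<kappa>} \<times> {..<\<kappa>} \<times> {..<\<kappa>})"
    "\<forall>x\<in>{..<\<kappa>}. \<forall>y\<in>{..<\<kappa>}. \<forall>z\<in>{..<\<kappa>}. p x y z \<in> {..<\<kappa>}"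
    by (rule inj_tripling[OF infinite_regularD(1)[OF reg]])
  define \<Gamma> where "\<Gamma> = {\<delta>. \<delta> < \<kappa> \<and> (\<exists>s. cofinal_seq l s \<delta>)}"
  have stat\<Gamma>: "stationary_in \<kappa> \<Gamma>" unfolding \<Gamma>_def by (rule stationary_cofinal_seq[OF \<kappa> l\<kappa> regl])
  define \<sigma> where "\<sigma> \<xi> = (SOME s. cofinal_seq l s \<xi>)" for \<xi>
  have \<sigma>: "cofinal_seq l (\<sigma> \<delta>) \<delta>" if "\<delta> \<in> \<Gamma>" for \<delta>
    using that someI_ex[of "\<lambda>s. cofinal_seq l s \<delta>"] by (simp add: \<sigma>_def \<Gamma>_def)
  define q where "q \<delta> = seq_index l (\<sigma> \<delta>)" for \<delta>
  have q: "q \<delta> \<eta> < l" if "\<delta> \<in> \<Gamma>" "\<eta> < \<delta>" for \<delta> \<eta>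
    unfolding q_def by (rule seq_index(1)[OF \<sigma>[OF that(1)] that(2)])
  \<comment> \<open>The third coordinate names a ladder point below \<beta> through
    \<open>e \<beta>\<close>, and \<open>y\<close> is the position of \<eta> in its ladder. If
    \<epsilon> names no such point, \<open>y\<close> may be meaningless; the default
    \<open>i0\<close> then keeps the colour below \<theta>.\<close>
  define c where "c = (\<lambda>(\<eta>, \<xi>, \<epsilon>) \<beta>. let y = q (inv_into {..<\<beta>} (e \<beta>) \<epsilon>) \<eta> in
    if \<xi> < y \<and> y < l then c' \<xi> y else i0)"
  show ?thesis
  proof (rule ontoI[where P = "{..<\<kappa>} \<times> {..<\<kappa>} \<times> {..<\<kappa>}" and code = "\<lambda>(x, y, z). p x y z" and c = c, OF p(1) _ i0])
    show "(\<lambda>(x, y, z). p x y z) ` ({..<\<kappa>} \<times> {..<\<kappa>} \<times> {..<\<kappa>}) \<subseteq> {..<\<kappa>}" using p(2) by auto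
    show "c u \<beta> < \<theta>" for u \<beta> using c'(1) i0 by (auto simp: c_def Let_def split: prod.split)
  next
    fix B and g :: "'a \<times> 'a \<times> 'a \<Rightarrow> 'a"
    assume "B \<in> positive {..<\<kappa>} (J_bd \<kappa>)" and "\<forall>u\<in>{..<\<kappa>} \<times> {..<\<kappa>} \<times> {..<\<kappa>}. g u < \<theta>"
    then have B: "B \<subseteq> {..<\<kappa>}" "\<not> bounded_in \<kappa> B" and g: "\<forall>x<\<kappa>. \<forall>y<\<kappa>. \<forall>z<\<kappa>. g (x, y, z) < \<theta>"
      by (auto simp: positive_J_bd)
    \<comment> \<open>The ladder points at which the slice of \<open>g\<close> at \<epsilon> is
      never met. Once these sets are nonstationary, a diagonal intersection of clubs avoids them
      all.\<close>
    define Bad where "Bad \<epsilon> = {\<delta>\<in>\<Gamma>. \<forall>\<eta><\<delta>. \<forall>\<xi><l. \<xi> < q \<delta> \<eta> \<longrightarrow> c' \<xi> (q \<delta> \<eta>) \<noteq> g (\<eta>, \<xi>, \<epsilon>)}" for \<epsilon>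
    have "\<not> stationary_in \<kappa> (Bad \<epsilon>)" if \<epsilon>: "\<epsilon> < \<kappa>" for \<epsilon>
    proof
      assume st: "stationary_in \<kappa> (Bad \<epsilon>)"
      define V where "V \<eta> = {q \<delta> \<eta> | \<delta>. \<delta> \<in> Bad \<epsilon> \<and> \<eta> < \<delta>}" for \<eta>
      \<comment> \<open>If the positions were unbounded in \<open>l\<close>, then \<open>c'\<close>
        would realise the colour \<open>g (\<eta>, \<xi>, \<epsilon>)\<close> at one of them for
        some \<xi>, against the definition of \<open>Bad\<close>.\<close>
      have "bounded_in l (V \<eta>)" if \<eta>: "\<eta> < \<kappa>" for \<eta>
      proof (rule ccontr)
        assume "\<not> bounded_in l (V \<eta>)"
        moreover have "V \<eta> \<subseteq> {..<l}" using q by (auto simp: V_def Bad_def)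
        ultimately obtain \<xi> where \<xi>: "\<xi> < l" "\<forall>i<\<theta>. \<exists>y\<in>V \<eta>. \<xi> < y \<and> c' \<xi> y = i" using c'(2) by blast
        then have "g (\<eta>, \<xi>, \<epsilon>) < \<theta>" using g \<eta> \<epsilon> l\<kappa> by simp
        then obtain y where "y \<in> V \<eta>" "\<xi> < y" "c' \<xi> y = g (\<eta>, \<xi>, \<epsilon>)" using \<xi> by blast
        then show False using \<xi>(1) by (auto simp: V_def Bad_def)
      qed
      then have "\<forall>\<eta><\<kappa>. \<exists>v<l. \<forall>y\<in>V \<eta>. y < v" by (auto simp: bounded_in_def)
      then obtain v where v: "\<forall>\<eta><\<kappa>. v \<eta> < l \<and> (\<forall>y\<in>V \<eta>. y < v \<eta>)" by metis
      then obtain w where w: "w < l" "\<not> bounded_in \<kappa> {\<eta>\<in>{..<\<kappa>}. v \<eta> = w}"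
        using pigeonhole_unbounded[OF reg infinite_regularD(2)[OF reg l\<kappa>] unbounded_lessThan, of v]
        by auto
      have "\<forall>x<\<kappa>. \<exists>n. n < \<kappa> \<and> x < n \<and> v n = w" using w(2) unfolding unbounded_iff[OF reg] by auto
      then obtain n where n: "\<forall>x<\<kappa>. n x < \<kappa> \<and> x < n x \<and> v (n x) = w" by metis
      \<comment> \<open>By closure, some \<eta> below \<delta> with \<open>v \<eta> = w\<close> lies
        beyond term \<open>w\<close> of the ladder at \<delta>. Its position exceeds
        \<open>w\<close>, although \<open>w\<close> bounds all positions in
        \<open>V \<eta>\<close>.\<close>
      obtain \<delta> where \<delta>: "\<delta> \<in> Bad \<epsilon>" "\<delta> < \<kappa>" "closed_under (\<lambda>x y z. n x) \<delta>"
        by (rule stationary_reflect[OF \<kappa> st l\<kappa>, of "\<lambda>x y z. n x" "\<lambda>x y. {..<\<kappa>}"])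
          (use n club_UNIV[OF reg] in auto)
      have \<Gamma>\<delta>: "\<delta> \<in> \<Gamma>" using \<delta> by (simp add: Bad_def)
      note \<sigma>\<delta> = \<sigma>[OF \<Gamma>\<delta>]
      have 1: "\<sigma> \<delta> w < \<delta>" using \<sigma>\<delta> w(1) by (simp add: cofinal_seq_def)
      then have 2: "n (\<sigma> \<delta> w) < \<delta>" using \<delta>(3) by (auto simp: closed_under_def)
      have 3: "\<sigma> \<delta> w < n (\<sigma> \<delta> w)" "v (n (\<sigma> \<delta> w)) = w" "n (\<sigma> \<delta> w) < \<kappa>" using n 1 \<delta>(2) by (auto dest: less_trans)
      have "w < q \<delta> (n (\<sigma> \<delta> w))" unfolding q_def by (rule seq_index_greater[OF \<sigma>\<delta> 2 3(1) w(1)])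
      moreover have "q \<delta> (n (\<sigma> \<delta> w)) \<in> V (n (\<sigma> \<delta> w))" using \<delta>(1) 2 by (auto simp: V_def)
      then have "q \<delta> (n (\<sigma> \<delta> w)) < w" using v 3 by auto
      ultimately show False by simp
    qed
    moreover have "Bad \<epsilon> \<subseteq> {..<\<kappa>}" for \<epsilon> by (auto simp: Bad_def \<Gamma>_def)
    ultimately have "\<forall>\<epsilon><\<kappa>. \<exists>D. club_in \<kappa> D \<and> Bad \<epsilon> \<inter> D = {}" unfolding stationary_in_def by blast
    then obtain D where D: "\<forall>\<epsilon><\<kappa>. club_in \<kappa> (D \<epsilon>) \<and> Bad \<epsilon> \<inter> D \<epsilon> = {}" by metis
    \<comment> \<open>The index \<open>e \<beta> \<delta>\<close> will be below \<mu>, hence below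
      \<delta>, whatever \<beta> is; so \<delta> can be chosen before \<beta>.\<close>
    obtain \<delta> where \<delta>: "\<delta> \<in> \<Gamma>" "\<delta> < \<kappa>" "\<mu> < \<delta>" "closed_under p \<delta>" "\<forall>x<\<delta>. \<forall>y<\<delta>. \<delta> \<in> D x"
      by (rule stationary_reflect[OF \<kappa> stat\<Gamma> d(2), of p "\<lambda>x y. D x"]) (use p(2) D in auto)
    obtain \<beta> where \<beta>: "\<beta> \<in> B" "\<delta> < \<beta>" using B(2) \<delta>(2) unfolding unbounded_iff[OF reg] by blast
    have \<beta>\<kappa>: "\<beta> < \<kappa>" using B \<beta> by auto
    define \<epsilon> where "\<epsilon> = e \<beta> \<delta>"
    have \<epsilon>: "\<epsilon> < \<mu>" "\<epsilon> < \<delta>" using e(2) \<beta>\<kappa> \<beta> \<delta>(3) by (auto simp: \<epsilon>_def dest: less_trans)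
    have inv: "inv_into {..<\<beta>} (e \<beta>) \<epsilon> = \<delta>"
      unfolding \<epsilon>_def using e(1) \<beta>\<kappa> \<beta> by (intro inv_into_f_f) auto
    have "\<delta> \<in> D \<epsilon>" using \<delta>(5) \<epsilon>(2) by blast
    then have "\<delta> \<notin> Bad \<epsilon>" using D \<epsilon> d(2) by (meson disjoint_iff less_trans)
    then obtain \<eta> \<xi> where *: "\<eta> < \<delta>" "\<xi> < l" "\<xi> < q \<delta> \<eta>" "c' \<xi> (q \<delta> \<eta>) = g (\<eta>, \<xi>, \<epsilon>)"
      using \<delta>(1) by (auto simp: Bad_def)
    have "c (\<eta>, \<xi>, \<epsilon>) \<beta> = g (\<eta>, \<xi>, \<epsilon>)"
      using * q[OF \<delta>(1) *(1)] by (simp add: c_def inv)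
    moreover have "\<xi> < \<delta>" using * l(1) \<delta>(3) by simp
    then have "p \<eta> \<xi> \<epsilon> < \<delta>" using \<delta>(4) * \<epsilon> by (simp add: closed_under_def)
    then have "p \<eta> \<xi> \<epsilon> < \<beta>" using \<beta>(2) by simp
    moreover have "(\<eta>, \<xi>, \<epsilon>) \<in> {..<\<kappa>} \<times> {..<\<kappa>} \<times> {..<\<kappa>}" using * \<epsilon> \<open>\<xi> < \<delta>\<close> \<delta>(2) by (auto dest: less_trans)
    ultimately show "\<exists>u\<in>{..<\<kappa>} \<times> {..<\<kappa>} \<times> {..<\<kappa>}. \<exists>\<beta>\<in>B. (\<lambda>(x, y, z). p x y z) u < \<beta> \<and> c u \<beta> = g u"
      using \<beta>(1) by (intro bexI[of _ "(\<eta>, \<xi>, \<epsilon>)"] bexI[of _ \<beta>]) auto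
  qed auto
qed

lemma succ_cardinal_of_infinite:
  assumes "succ_cardinal_of \<mu> \<kappa>" "uncountable {..<\<kappa>}"
  shows "infinite {..<\<mu>}"
proof
  assume "finite {..<\<mu>}"
  then have "finite (Field (cardSuc (ordr \<mu>)))"
    using assms(1) by (simp add: succ_cardinal_of_def cardSuc_finite)
  moreover have "ordr \<kappa> =o cardSuc (ordr \<mu>)" using assms(1) by (simp add: succ_cardinal_of_def)
  ultimately have "finite (Field (ordr \<kappa>))"
    using card_of_cong card_of_ordIso_finite by blast
  then show False using assms(2) countable_finite by auto
qed

lemma onto_J_bd_succ:
  fixes \<kappa> :: "'a::wellorder"
  assumes s: "succ_cardinal_of \<mu> \<kappa>" "uncountable {..<\<kappa>}" and \<theta>: "infinite_regular \<theta>" "\<theta> < \<kappa>"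
  shows "onto \<kappa> {..<\<kappa>} (J_bd \<kappa>) \<theta>"
proof -
  note d = succ_cardinal_ofD[OF s(1) succ_cardinal_of_infinite[OF s]]
  have "\<not> \<mu> < \<theta>"
    using d(3)[OF \<theta>(2)] infinite_regularD(2)[OF \<theta>(1), of \<mu>] not_ordLess_ordLeq by blast
  then have "\<theta> = \<mu> \<or> \<theta> < \<mu>" by auto
  then show ?thesis using onto_J_bd_pred[OF s(1)] onto_J_bd_less_pred[OF s(1) \<theta>(1)] \<theta>(1) by blast
qed

section \<open>Nonreflecting stationary sets and restrictions of the nonstationary ideal\<close>

definition limit_ord :: "'a::wellorder \<Rightarrow> bool" where
  "limit_ord \<delta> \<longleftrightarrow> (\<forall>x<\<delta>. \<exists>y<\<delta>. x < y)"

text \<open>The type may have a largest element, where this is unspecified; hence the hypothesis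
  \<open>d < \<delta>\<close> in the facts about it.\<close>

definition osucc :: "'a::wellorder \<Rightarrow> 'a" where
  "osucc d = (LEAST x. d < x)"

lemma osucc:
  assumes "d < \<delta>"
  shows "d < osucc d" "osucc d \<le> \<delta>" "x < osucc d \<longleftrightarrow> x \<le> d"
proof -
  show 1: "d < osucc d" unfolding osucc_def by (rule LeastI[of "\<lambda>x. d < x", OF assms])
  show "osucc d \<le> \<delta>" unfolding osucc_def by (rule Least_le[of "\<lambda>x. d < x", OF assms])
  show "x < osucc d \<longleftrightarrow> x \<le> d"
    using 1 not_less_Least[of x "\<lambda>x. d < x"] unfolding osucc_def by (auto simp: not_less)
qed

lemma osucc_not_limit:
  assumes "d < \<delta>" shows "\<not> limit_ord (osucc d)"
proof
  assume "limit_ord (osucc d)"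
  then obtain y where "y < osucc d" "d < y" using osucc(1)[OF assms] unfolding limit_ord_def by blast
  then show False using osucc(3)[OF assms, of y] by simp
qed

text \<open>Taking the least accumulation point of a club in \<open>S\<close> shows that stationarily many points of \<open>S\<close>
  fail to reflect the limit points in \<open>S\<close>. At a point of countable cofinality the witnessing club
  consists of successors.\<close>
lemma stationary_nonreflecting_subset:
  fixes \<kappa> :: "'a::wellorder"
  assumes \<kappa>: "regular_uncountable \<kappa>" and S: "stationary_in \<kappa> S"
  shows "stationary_in \<kappa> {\<delta>\<in>S. limit_ord \<delta> \<and> (\<exists>C. club_in \<delta> C \<and> C \<inter> {x\<in>S. limit_ord x} = {})}"
    (is "stationary_in \<kappa> ?S'")
  unfolding stationary_in_def
proof (intro conjI allI impI notI)
  note reg = regular_uncountable_regular[OF \<kappa>]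
  show "?S' \<subseteq> {..<\<kappa>}" using S by (auto simp: stationary_in_def)
  fix D assume D: "club_in \<kappa> D" and disj: "?S' \<inter> D = {}"
  define acc where "acc \<delta> \<longleftrightarrow> (\<exists>d\<in>D. d < \<delta>) \<and> (\<forall>\<alpha><\<delta>. \<exists>d\<in>D. \<alpha> < d \<and> d < \<delta>)" for \<delta>
  obtain \<delta>0 where "\<delta>0 \<in> S \<and> \<delta>0 < \<kappa> \<and> acc \<delta>0"
  proof -
    have "\<forall>x<\<kappa>. \<exists>d. d < \<kappa> \<and> d \<in> D \<and> x < d" using D unfolding club_in_def by blast
    then obtain n where n: "\<forall>x<\<kappa>. n x < \<kappa> \<and> n x \<in> D \<and> x < n x" by metis
    obtain \<gamma> where \<gamma>: "\<gamma> < \<kappa>" by (rule infinite_regular_nonempty[OF reg])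
    obtain \<delta> where \<delta>: "\<delta> \<in> S" "\<delta> < \<kappa>" "\<gamma> < \<delta>" "closed_under (\<lambda>x y z. n x) \<delta>"
      by (rule stationary_reflect[OF \<kappa> S \<gamma>, of "\<lambda>x y z. n x" "\<lambda>x y. {..<\<kappa>}"])
        (use n club_UNIV[OF reg] in auto)
    have *: "\<exists>d\<in>D. \<alpha> < d \<and> d < \<delta>" if "\<alpha> < \<delta>" for \<alpha>
    proof (rule bexI[of _ "n \<alpha>"])
      have "\<alpha> < \<kappa>" using that \<delta>(2) by simp
      then show "n \<alpha> \<in> D" "\<alpha> < n \<alpha> \<and> n \<alpha> < \<delta>" using n \<delta>(4) that by (auto simp: closed_under_def)
    qed
    then have "acc \<delta>" unfolding acc_def using \<delta>(3) by blast
    then show thesis using that \<delta> by blast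
  qed
  then have ex: "\<exists>\<delta>. \<delta> \<in> S \<and> \<delta> < \<kappa> \<and> acc \<delta>" by blast
  define \<delta> where "\<delta> = (LEAST \<delta>. \<delta> \<in> S \<and> \<delta> < \<kappa> \<and> acc \<delta>)"
  have \<delta>: "\<delta> \<in> S" "\<delta> < \<kappa>" "acc \<delta>"
    using LeastI_ex[OF ex] by (simp_all add: \<delta>_def)
  have min: "\<not> (x \<in> S \<and> x < \<kappa> \<and> acc x)" if "x < \<delta>" for x
    using not_less_Least[OF that[unfolded \<delta>_def]] .
  have lim: "limit_ord \<delta>" using \<delta>(3) by (auto simp: acc_def limit_ord_def)
  have "D \<inter> {..<\<delta>} \<noteq> {}" "\<forall>\<alpha><\<delta>. \<exists>\<beta>\<in>D \<inter> {..<\<delta>}. \<alpha> < \<beta>" using \<delta>(3) by (auto simp: acc_def)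
  then have "\<delta> \<in> D" using D \<delta>(2) unfolding club_in_def by blast
  \<comment> \<open>The limit \<delta> belongs to both \<open>S\<close> and \<open>D\<close>, hence
    not to \<open>?S'\<close>: no club in \<delta> avoids the limit points in
    \<open>S\<close>.\<close>
  then have meets: "C \<inter> {x\<in>S. limit_ord x} \<noteq> {}" if "club_in \<delta> C" for C
    using disj \<delta>(1) lim that by blast
  have sub: "S \<subseteq> {..<\<kappa>}" using S by (simp add: stationary_in_def)
  show False
  proof (cases "\<forall>\<alpha><\<delta>. \<exists>x<\<delta>. acc x \<and> \<alpha> < x")
    case True
    \<comment> \<open>The accumulation points of \<open>D\<close> below \<delta> form a club in
      \<delta>, so one of them lies in \<open>S\<close>, contradicting the minimality of
      \<delta>.\<close>
    have "club_in \<delta> {x. x < \<delta> \<and> acc x}"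
      unfolding club_in_def
    proof (intro conjI allI impI)
      fix \<epsilon> assume \<epsilon>: "\<epsilon> < \<delta>" and *: "{x. x < \<delta> \<and> acc x} \<inter> {..<\<epsilon>} \<noteq> {} \<and> (\<forall>\<alpha><\<epsilon>. \<exists>\<beta>\<in>{x. x < \<delta> \<and> acc x} \<inter> {..<\<epsilon>}. \<alpha> < \<beta>)"
      have "\<exists>d\<in>D. \<alpha> < d \<and> d < \<epsilon>" if "\<alpha> < \<epsilon>" for \<alpha>
      proof -
        obtain x where "acc x" "x < \<epsilon>" "\<alpha> < x" using * \<open>\<alpha> < \<epsilon>\<close> by blast
        then show ?thesis unfolding acc_def by (meson less_trans)
      qed
      moreover have "\<exists>d\<in>D. d < \<epsilon>"
      proof -
        obtain x where "acc x" "x < \<epsilon>" using * by blast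
        then show ?thesis unfolding acc_def by (meson less_trans)
      qed
      ultimately show "\<epsilon> \<in> {x. x < \<delta> \<and> acc x}" using \<epsilon> by (simp add: acc_def)
    qed (use True in auto)
    then obtain x where "x < \<delta>" "acc x" "x \<in> S" using meets by blast
    then show False using min sub by auto
  next
    case False
    then obtain \<gamma> where \<gamma>: "\<gamma> < \<delta>" "\<forall>x<\<delta>. acc x \<longrightarrow> x \<le> \<gamma>" by (meson not_less)
    \<comment> \<open>No accumulation point of \<open>D\<close> lies strictly between \<gamma> and
      \<delta>, so \<open>C\<close> has no limit below \<delta> and is closed. All its members are
      successors, so it misses the limit points in \<open>S\<close>.\<close>
    define C where "C = osucc ` {d\<in>D. \<gamma> < d \<and> d < \<delta>}"
    have below: "osucc d < \<delta>" if "d < \<delta>" for d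
    proof -
      obtain y where "d < y" "y < \<delta>" using lim \<open>d < \<delta>\<close> unfolding limit_ord_def by blast
      then show ?thesis using osucc(2)[of d y] by simp
    qed
    have "club_in \<delta> C"
      unfolding club_in_def
    proof (intro conjI allI impI)
      show "C \<subseteq> {..<\<delta>}" using below by (auto simp: C_def)
    next
      fix \<alpha> assume "\<alpha> < \<delta>"
      then have "max \<alpha> \<gamma> < \<delta>" using \<gamma> by simp
      then obtain d where d: "d \<in> D" "max \<alpha> \<gamma> < d" "d < \<delta>" using \<delta>(3) unfolding acc_def by blast
      then have "\<alpha> < osucc d" using osucc(1)[OF d(3)] by auto
      then show "\<exists>\<beta>\<in>C. \<alpha> < \<beta>" using d by (auto simp: C_def)
    next
      fix \<epsilon> assume \<epsilon>: "\<epsilon> < \<delta>" and *: "C \<inter> {..<\<epsilon>} \<noteq> {} \<and> (\<forall>\<alpha><\<epsilon>. \<exists>\<beta>\<in>C \<inter> {..<\<epsilon>}. \<alpha> < \<beta>)"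
      have get: "\<exists>d\<in>D. \<alpha> < d \<and> \<gamma> < d \<and> d < \<epsilon>" if \<alpha>: "\<alpha> < \<epsilon>" for \<alpha>
      proof -
        obtain \<beta> where \<beta>: "\<beta> \<in> C" "\<beta> < \<epsilon>" "\<alpha> < \<beta>" using * \<alpha> by blast
        \<comment> \<open>Going to a second member of \<open>C\<close> compensates for the shift by
          \<open>osucc\<close> and puts \<open>d\<close> itself above \<alpha>.\<close>
        then obtain \<beta>' where "\<beta>' \<in> C" "\<beta>' < \<epsilon>" "\<beta> < \<beta>'" using * by blast
        then obtain d where d: "d \<in> D" "\<gamma> < d" "d < \<delta>" "osucc d < \<epsilon>" "\<beta> < osucc d" by (auto simp: C_def)
        then have "\<beta> \<le> d" using osucc(3)[OF d(3), of \<beta>] by blast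
        then have "\<alpha> < d" using \<beta> by simp
        moreover have "d < \<epsilon>" using d osucc(1)[OF d(3)] by simp
        ultimately show ?thesis using d by blast
      qed
      obtain \<beta> where "\<beta> < \<epsilon>" using * by blast
      then obtain d where d: "d \<in> D" "\<gamma> < d" "d < \<epsilon>" using get by blast
      then have "acc \<epsilon>" unfolding acc_def using get by blast
      then show "\<epsilon> \<in> C" using \<gamma> \<epsilon> d by fastforce
    qed
    then obtain x where "x \<in> C" "limit_ord x" using meets by blast
    then show False using osucc_not_limit by (auto simp: C_def)
  qed
qed

text \<open>Each \<beta> in \<open>S'\<close> has a club \<open>C \<beta>\<close> missing
  \<open>S'\<close>, and \<open>m i \<beta>\<close> is its next element after \<open>i\<close>. For
  some \<open>i\<close>, unboundedly many values of \<open>m i\<close> are each attained at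
  unboundedly many \<beta> in \<open>B\<close>. The projections then reach \<open>g\<close> on these
  values, with \<beta> as large as the code requires.\<close>

lemma onto_NS_restr:
  fixes \<kappa> :: "'a::wellorder"
  assumes \<kappa>: "regular_uncountable \<kappa>" and S: "stationary_in \<kappa> S"
  obtains S' where "S' \<subseteq> S" "stationary_in \<kappa> S'"
    "\<forall>\<theta><\<kappa>. infinite_regular \<theta> \<longrightarrow> onto \<kappa> S' (NS_restr \<kappa> S') \<theta>"
proof -
  note reg = regular_uncountable_regular[OF \<kappa>]
  define S' where "S' = {\<delta>\<in>S. limit_ord \<delta> \<and> (\<exists>C. club_in \<delta> C \<and> C \<inter> {x\<in>S. limit_ord x} = {})}"
  have st: "stationary_in \<kappa> S'" unfolding S'_def by (rule stationary_nonreflecting_subset[OF \<kappa> S])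
  have sub: "S' \<subseteq> {..<\<kappa>}" using st by (simp add: stationary_in_def)
  have "\<forall>\<delta>. \<exists>C. \<delta> \<in> S' \<longrightarrow> club_in \<delta> C \<and> C \<inter> S' = {}" by (auto simp: S'_def)
  then obtain C where C: "\<forall>\<delta>. \<delta> \<in> S' \<longrightarrow> club_in \<delta> (C \<delta>) \<and> C \<delta> \<inter> S' = {}" by metis
  define m where "m i \<beta> = (LEAST x. x \<in> C \<beta> \<and> i < x)" for i \<beta>
  have m: "m i \<beta> \<in> C \<beta>" "i < m i \<beta>" "m i \<beta> < \<beta>" if "\<beta> \<in> S'" "i < \<beta>" for i \<beta>
  proof -
    have cl: "club_in \<beta> (C \<beta>)" using C that(1) by blast
    then have "\<exists>x. x \<in> C \<beta> \<and> i < x" using that(2) unfolding club_in_def by blast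
    then show "m i \<beta> \<in> C \<beta>" "i < m i \<beta>"
      unfolding m_def by (metis (mono_tags, lifting) LeastI_ex)+
    then show "m i \<beta> < \<beta>" using cl unfolding club_in_def by blast
  qed
  have "onto \<kappa> S' (NS_restr \<kappa> S') \<theta>" if \<theta>: "infinite_regular \<theta>" "\<theta> < \<kappa>" for \<theta>
  proof -
    obtain i0 where i0: "i0 < \<theta>" by (rule infinite_regular_nonempty[OF \<theta>(1)])
    obtain p where p: "\<forall>u v x. p u v x < \<theta>"
      "\<forall>X\<subseteq>{..<\<kappa>}. \<not> bounded_in \<kappa> X \<longrightarrow> (\<exists>u<\<kappa>. \<exists>v<\<kappa>. \<forall>i<\<theta>. \<exists>x\<in>X. p u v x = i)"
      by (rule onto_projections[OF \<kappa> \<theta>])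
    obtain t where t: "inj_on (\<lambda>(x, y, z). t x y z) ({..<\<kappa>} \<times> {..<\<kappa>} \<times> {..<\<kappa>})"
      "\<forall>x\<in>{..<\<kappa>}. \<forall>y\<in>{..<\<kappa>}. \<forall>z\<in>{..<\<kappa>}. t x y z \<in> {..<\<kappa>}"
      by (rule inj_tripling[OF infinite_regularD(1)[OF reg]])
    define c where "c = (\<lambda>(i, u, v) \<beta>. p u v (m i \<beta>))"
    show ?thesis
    proof (rule ontoI[where P = "{..<\<kappa>} \<times> {..<\<kappa>} \<times> {..<\<kappa>}" and code = "\<lambda>(x, y, z). t x y z" and c = c, OF t(1) _ i0])
      show "(\<lambda>(x, y, z). t x y z) ` ({..<\<kappa>} \<times> {..<\<kappa>} \<times> {..<\<kappa>}) \<subseteq> {..<\<kappa>}" using t(2) by auto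
      show "c u \<beta> < \<theta>" for u \<beta> using p(1) by (simp add: c_def split: prod.split)
      show "S' \<subseteq> {..<\<kappa>}" by (rule sub)
    next
      fix B and g :: "'a \<times> 'a \<times> 'a \<Rightarrow> 'a"
      assume "B \<in> positive S' (NS_restr \<kappa> S')" and "\<forall>u\<in>{..<\<kappa>} \<times> {..<\<kappa>} \<times> {..<\<kappa>}. g u < \<theta>"
      then have B: "B \<subseteq> S'" "stationary_in \<kappa> B" and g: "\<forall>x<\<kappa>. \<forall>y<\<kappa>. \<forall>z<\<kappa>. g (x, y, z) < \<theta>"
        using positive_NS_restr[OF sub] by auto
      define Y where "Y i = {x. x < \<kappa> \<and> \<not> bounded_in \<kappa> {\<beta>\<in>B. i < \<beta> \<and> m i \<beta> = x}}" for i
      have "\<exists>i<\<kappa>. \<not> bounded_in \<kappa> (Y i)"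
      proof (rule ccontr)
        assume "\<not> ?thesis"
        then have "\<forall>i<\<kappa>. \<exists>\<eta><\<kappa>. \<forall>x\<in>Y i. x < \<eta>" by (auto simp: bounded_in_def)
        then obtain \<eta> where \<eta>: "\<forall>i<\<kappa>. \<eta> i < \<kappa> \<and> (\<forall>x\<in>Y i. x < \<eta> i)" by metis
        \<comment> \<open>A value outside \<open>Y i\<close> is attained only at boundedly many
          \<beta> in \<open>B\<close>; \<open>b i x\<close> will bound them.\<close>
        have "\<exists>b<\<kappa>. x \<notin> Y i \<longrightarrow> (\<forall>\<beta>\<in>B. i < \<beta> \<and> m i \<beta> = x \<longrightarrow> \<beta> < b)" if "i < \<kappa>" "x < \<kappa>" for i x
        proof (cases "x \<in> Y i")
          case False
          then have "bounded_in \<kappa> {\<beta>\<in>B. i < \<beta> \<and> m i \<beta> = x}" using that by (simp add: Y_def)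
          then show ?thesis unfolding bounded_in_def by blast
        qed (use that in blast)
        then obtain b where b: "\<forall>i<\<kappa>. \<forall>x<\<kappa>. b i x < \<kappa> \<and> (x \<notin> Y i \<longrightarrow> (\<forall>\<beta>\<in>B. i < \<beta> \<and> m i \<beta> = x \<longrightarrow> \<beta> < b i x))"
          by metis
        have refl: "\<exists>\<delta>. \<delta> \<in> B \<and> \<delta> < \<kappa> \<and> \<gamma> < \<delta> \<and> (\<forall>i<\<delta>. \<eta> i < \<delta>) \<and> (\<forall>i<\<delta>. \<forall>x<\<delta>. b i x < \<delta>)"
          if \<gamma>: "\<gamma> < \<kappa>" for \<gamma>
        proof -
          obtain \<delta> where \<delta>: "\<delta> \<in> B" "\<delta> < \<kappa>" "\<gamma> < \<delta>" "closed_under (\<lambda>x y z. max (\<eta> x) (b x y)) \<delta>"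
            by (rule stationary_reflect[OF \<kappa> B(2) \<gamma>, of "\<lambda>x y z. max (\<eta> x) (b x y)" "\<lambda>x y. {..<\<kappa>}"])
              (use \<eta> b club_UNIV[OF reg] in auto)
          then have "\<forall>i<\<delta>. \<forall>x<\<delta>. \<eta> i < \<delta> \<and> b i x < \<delta>" unfolding closed_under_def by auto
          then show ?thesis using \<delta> by (intro exI[of _ \<delta>]) blast
        qed
        obtain \<gamma> where \<gamma>: "\<gamma> < \<kappa>" by (rule infinite_regular_nonempty[OF reg])
        \<comment> \<open>Two points of \<open>B\<close> are taken, \<delta> closed under
          \<open>\<eta>\<close> and \<beta> above it closed under \<open>b\<close>. For
          \<open>i\<close> below \<delta>, the second closure puts \<open>m i \<beta>\<close> into
          \<open>Y i\<close> and the first keeps it below \<delta>. So \<delta> is a limit of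
          \<open>C \<beta>\<close>, which was to miss \<open>S'\<close>.\<close>
        obtain \<delta> where \<delta>: "\<delta> \<in> B" "\<delta> < \<kappa>" "\<gamma> < \<delta>" "\<forall>i<\<delta>. \<eta> i < \<delta>" using refl[OF \<gamma>] by blast
        obtain \<beta> where \<beta>: "\<beta> \<in> B" "\<beta> < \<kappa>" "\<delta> < \<beta>" "\<forall>i<\<beta>. \<forall>x<\<beta>. b i x < \<beta>" using refl[OF \<delta>(2)] by blast
        have S'\<beta>: "\<beta> \<in> S'" using \<beta> B by blast
        have small: "m i \<beta> < \<delta>" if i: "i < \<delta>" for i
        proof -
          have i\<beta>: "i < \<beta>" "i < \<kappa>" using i \<beta>(2,3) by auto
          have mb: "m i \<beta> < \<beta>" by (rule m(3)[OF S'\<beta> i\<beta>(1)])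
          have "m i \<beta> \<in> Y i"
          proof (rule ccontr)
            assume "m i \<beta> \<notin> Y i"
            then have "\<beta> < b i (m i \<beta>)" using b i\<beta> mb \<beta>(1,2) by auto
            then show False using \<beta>(4) i\<beta>(1) mb by (meson less_asym)
          qed
          then have "m i \<beta> < \<eta> i" using \<eta> i\<beta> by blast
          then show ?thesis using \<delta>(4) i by (meson less_trans)
        qed
        have "\<forall>\<alpha><\<delta>. \<exists>x\<in>C \<beta> \<inter> {..<\<delta>}. \<alpha> < x"
          using small m[OF S'\<beta>] \<beta>(3) by (meson IntI less_trans lessThan_iff)
        moreover from this have "C \<beta> \<inter> {..<\<delta>} \<noteq> {}" using \<delta>(3) by blast
        ultimately have "\<delta> \<in> C \<beta>" using C S'\<beta> \<beta>(3) unfolding club_in_def by blast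
        then show False using C S'\<beta> \<delta>(1) B(1) by blast
      qed
      then obtain i where i: "i < \<kappa>" "\<not> bounded_in \<kappa> (Y i)" by blast
      moreover have "Y i \<subseteq> {..<\<kappa>}" by (auto simp: Y_def)
      ultimately obtain u v where uv: "u < \<kappa>" "v < \<kappa>" "\<forall>j<\<theta>. \<exists>x\<in>Y i. p u v x = j" using p(2) by blast
      have "g (i, u, v) < \<theta>" using g i uv by blast
      then obtain x where x: "x \<in> Y i" "p u v x = g (i, u, v)" using uv(3) by blast
      have "t i u v < \<kappa>" using t(2) i(1) uv by simp
      then obtain \<beta> where "\<beta> \<in> B" "m i \<beta> = x" "t i u v < \<beta>"
        using x(1) unfolding Y_def unbounded_iff[OF reg] by blast
      then show "\<exists>w\<in>{..<\<kappa>} \<times> {..<\<kappa>} \<times> {..<\<kappa>}. \<exists>\<beta>\<in>B. (\<lambda>(x, y, z). t x y z) w < \<beta> \<and> c w \<beta> = g w"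
        using x(2) i(1) uv by (intro bexI[of _ "(i, u, v)"] bexI[of _ \<beta>]) (auto simp: c_def)
    qed
  qed
  then show ?thesis using that[of S'] st by (auto simp: S'_def)
qed

section \<open>Guessing principles: coding of functions, stick and diamond star\<close>

locale pairing =
  fixes \<kappa> :: "'a::wellorder" and pr :: "'a \<Rightarrow> 'a \<Rightarrow> 'a" and i0 :: 'a
  assumes pr_inj: "\<forall>x\<in>{..<\<kappa>}. \<forall>y\<in>{..<\<kappa>}. \<forall>x'\<in>{..<\<kappa>}. \<forall>y'\<in>{..<\<kappa>}. pr x y = pr x' y' \<longrightarrow> x = x' \<and> y = y'"
    and pr_less: "\<forall>x\<in>{..<\<kappa>}. \<forall>y\<in>{..<\<kappa>}. pr x y \<in> {..<\<kappa>}"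
    and i0: "i0 < \<kappa>"
begin

text \<open>Coding functions as sets of ordinals turns guesses for subsets of \<kappa> into guesses
  for functions.\<close>

definition graph :: "('a \<Rightarrow> 'a) \<Rightarrow> 'a set" where
  "graph g = (\<lambda>\<eta>. pr \<eta> (g \<eta>)) ` {..<\<kappa>}"

text \<open>A guess \<open>X\<close> is arbitrary and may provide several values at \<eta>, or none;
  choice and the default \<open>i0\<close> always yield a colour below \<kappa>.\<close>

definition decode :: "'a set \<Rightarrow> 'a \<Rightarrow> 'a" where
  "decode X \<eta> = (if \<exists>i<\<kappa>. pr \<eta> i \<in> X then SOME i. i < \<kappa> \<and> pr \<eta> i \<in> X else i0)"

lemma pr_eqD: "pr x y = pr x' y' \<Longrightarrow> x < \<kappa> \<Longrightarrow> y < \<kappa> \<Longrightarrow> x' < \<kappa> \<Longrightarrow> y' < \<kappa> \<Longrightarrow> x = x' \<and> y = y'"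
  using pr_inj by (meson lessThan_iff)

lemma decode_less: "decode X \<eta> < \<kappa>"
proof (cases "\<exists>i<\<kappa>. pr \<eta> i \<in> X")
  case True
  then show ?thesis using someI_ex[of "\<lambda>i. i < \<kappa> \<and> pr \<eta> i \<in> X"] by (simp add: decode_def)
qed (auto simp: decode_def i0)

lemma pr_mem_graph:
  assumes "\<forall>\<eta><\<kappa>. g \<eta> < \<kappa>" "\<eta> < \<kappa>" "i < \<kappa>" "pr \<eta> i \<in> graph g"
  shows "i = g \<eta>"
proof -
  obtain x where "x < \<kappa>" "pr \<eta> i = pr x (g x)" using assms(4) by (auto simp: graph_def)
  then show ?thesis using pr_eqD[of \<eta> i x "g x"] assms(1-3) by auto
qed

lemma decode_eq:
  assumes g: "\<forall>\<eta><\<kappa>. g \<eta> < \<kappa>" and \<eta>: "\<eta> < \<kappa>" and X: "X \<subseteq> graph g" "pr \<eta> (g \<eta>) \<in> X"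
  shows "decode X \<eta> = g \<eta>"
proof -
  have ex: "\<exists>i. i < \<kappa> \<and> pr \<eta> i \<in> X" using X g \<eta> by blast
  have "decode X \<eta> < \<kappa> \<and> pr \<eta> (decode X \<eta>) \<in> X"
    using someI_ex[OF ex] ex by (simp add: decode_def)
  then show ?thesis using pr_mem_graph[OF g \<eta>] X(1) by blast
qed

lemma graph_subset: "\<forall>\<eta><\<kappa>. g \<eta> < \<kappa> \<Longrightarrow> graph g \<subseteq> {..<\<kappa>}"
  using pr_less by (auto simp: graph_def)

lemma pr_graph: "\<eta> < \<kappa> \<Longrightarrow> pr \<eta> (g \<eta>) \<in> graph g"
  by (auto simp: graph_def)

end

lemma exists_pairing:
  assumes "infinite_regular \<kappa>"
  obtains pr i0 where "pairing \<kappa> pr i0"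
proof -
  obtain pr where "\<forall>x\<in>{..<\<kappa>}. \<forall>y\<in>{..<\<kappa>}. \<forall>x'\<in>{..<\<kappa>}. \<forall>y'\<in>{..<\<kappa>}. pr x y = pr x' y' \<longrightarrow> x = x' \<and> y = y'"
    "\<forall>x\<in>{..<\<kappa>}. \<forall>y\<in>{..<\<kappa>}. pr x y \<in> {..<\<kappa>}"
    by (rule inj_pairing[OF infinite_regularD(1)[OF assms]])
  moreover obtain i0 where "i0 < \<kappa>" by (rule infinite_regular_nonempty[OF assms])
  ultimately have "pairing \<kappa> pr i0" by (rule pairing.intro)
  then show ?thesis by (rule that)
qed

text \<open>Recursion along an injection of \<open>J\<close> into \<mu>: at each stage fewer than
  \<mu> values have been used, so \<open>F x\<close> still has a new one.\<close>

lemma inj_choice: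
  fixes F :: "'b \<Rightarrow> 'a::wellorder set" and \<mu> :: 'a
  assumes J: "|J| \<le>o |{..<\<mu>}|" and \<mu>: "\<And>\<alpha>. \<alpha> < \<mu> \<Longrightarrow> |{..<\<alpha>}| <o |{..<\<mu>}|"
    and F: "\<forall>x\<in>J. |{..<\<mu>}| \<le>o |F x|"
  shows "\<exists>t. inj_on t J \<and> (\<forall>x\<in>J. t x \<in> F x)"
proof -
  obtain j where j: "inj_on j J" "j ` J \<subseteq> {..<\<mu>}" using J unfolding card_of_ordLeq[symmetric] by blast
  have "\<exists>f. \<forall>k. k \<in> j ` J \<longrightarrow> f k \<in> F (inv_into J j k) \<and> f k \<notin> f ` {..<k}"
  proof (rule dependent_wellorder_choice)
    fix r :: 'a and f g :: "'a \<Rightarrow> 'a" and k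
    assume "\<And>y. y < k \<Longrightarrow> f y = g y"
    then have "f ` {..<k} = g ` {..<k}" by auto
    then show "(k \<in> j ` J \<longrightarrow> r \<in> F (inv_into J j k) \<and> r \<notin> f ` {..<k}) =
      (k \<in> j ` J \<longrightarrow> r \<in> F (inv_into J j k) \<and> r \<notin> g ` {..<k})" by simp
  next
    fix k and f :: "'a \<Rightarrow> 'a"
    show "\<exists>r. k \<in> j ` J \<longrightarrow> r \<in> F (inv_into J j k) \<and> r \<notin> f ` {..<k}"
    proof (cases "k \<in> j ` J")
      case True
      then have "inv_into J j k \<in> J" by (rule inv_into_into)
      then have 1: "|{..<\<mu>}| \<le>o |F (inv_into J j k)|" using F by blast
      have "k < \<mu>" using True j(2) by blast
      then have "|f ` {..<k}| <o |{..<\<mu>}|"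
        using \<mu> card_of_image ordLeq_ordLess_trans by blast
      then have "|f ` {..<k}| <o |F (inv_into J j k)|" using 1 ordLess_ordLeq_trans by blast
      then have "\<not> F (inv_into J j k) \<subseteq> f ` {..<k}" using card_of_mono1 not_ordLess_ordLeq by blast
      then show ?thesis by blast
    qed auto
  qed
  then obtain f where f: "\<forall>k. k \<in> j ` J \<longrightarrow> f k \<in> F (inv_into J j k) \<and> f k \<notin> f ` {..<k}" by blast
  have "inj_on (f \<circ> j) J"
  proof (rule inj_onI)
    fix x y assume xy: "x \<in> J" "y \<in> J" "(f \<circ> j) x = (f \<circ> j) y"
    then have "f (j x) \<notin> f ` {..<j x}" "f (j y) \<notin> f ` {..<j y}" using f by blast+
    then have "\<not> j x < j y" "\<not> j y < j x" using xy(3) by (metis comp_apply imageI lessThan_iff)+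
    then show "x = y" using j(1) xy by (auto dest: inj_onD)
  qed
  moreover have "\<forall>x\<in>J. (f \<circ> j) x \<in> F x" using f j(1) by (auto simp: inv_into_f_f)
  ultimately show ?thesis by blast
qed

text \<open>Some \<open>X\<close> in the family is a subset of the graph of \<open>g\<close>; its
  domain has size \<mu> and is therefore bounded in \<kappa>. At every large enough \<beta> this
  \<open>X\<close> owns an argument in its domain, where decoding \<open>X\<close> returns the value
  of \<open>g\<close>.\<close>

lemma onto_J_bd_stick:
  fixes \<kappa> :: "'a::wellorder"
  assumes st: "stick \<kappa>" and unc: "uncountable {..<\<kappa>}"
  shows "onto \<kappa> {..<\<kappa>} (J_bd \<kappa>) \<kappa>"
proof -
  obtain \<mu> \<X> where s: "succ_cardinal_of \<mu> \<kappa>" and \<X>: "\<X> \<subseteq> subsets_of_card \<kappa> \<mu>" "|\<X>| =o ordr \<kappa>"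
    "\<forall>B \<in> subsets_of_card \<kappa> \<kappa>. \<exists>X\<in>\<X>. X \<subseteq> B"
    using st unfolding stick_def by blast
  note d = succ_cardinal_ofD[OF s succ_cardinal_of_infinite[OF s unc]]
  note \<kappa> = d(1) and reg = regular_uncountable_regular[OF d(1)]
  have c\<kappa>: "|{..<\<kappa>}| =o ordr \<kappa>" by (rule card_of_lessThan_ordr) (use reg in \<open>simp add: infinite_regular_def\<close>)
  have c\<mu>: "|{..<\<mu>}| =o ordr \<mu>" by (rule card_of_lessThan_ordr) (use s in \<open>simp add: succ_cardinal_of_def\<close>)
  obtain pr i0 where "pairing \<kappa> pr i0" by (rule exists_pairing[OF reg])
  then interpret pairing \<kappa> pr i0 .
  have "|\<X>| \<le>o |{..<\<kappa>}|"
    using \<X>(2) c\<kappa> ordIso_symmetric ordIso_transitive ordIso_imp_ordLeq by blast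
  then obtain idx where idx: "inj_on idx \<X>" "idx ` \<X> \<subseteq> {..<\<kappa>}" unfolding card_of_ordLeq[symmetric] by blast
  define dom where "dom X = {\<eta>. \<eta> < \<kappa> \<and> (\<exists>i<\<kappa>. pr \<eta> i \<in> X)}" for X
  \<comment> \<open>Indices below \<beta> leave at most \<mu> many guesses, and large domains allow
    distinct arguments to be chosen for them.\<close>
  define \<Y> where "\<Y> \<beta> = {X\<in>\<X>. idx X < \<beta> \<and> |{..<\<mu>}| \<le>o |dom X| \<and> dom X \<subseteq> {..<\<beta>}}" for \<beta>
  have "\<exists>t. inj_on t (\<Y> \<beta>) \<and> (\<forall>X\<in>\<Y> \<beta>. t X \<in> dom X)" if "\<beta> < \<kappa>" for \<beta>
  proof (rule inj_choice[OF _ d(4)])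
    have "inj_on idx (\<Y> \<beta>)" by (rule inj_on_subset[OF idx(1)]) (auto simp: \<Y>_def)
    moreover have "idx ` \<Y> \<beta> \<subseteq> {..<\<beta>}" by (auto simp: \<Y>_def)
    ultimately have "|\<Y> \<beta>| \<le>o |{..<\<beta>}|" unfolding card_of_ordLeq[symmetric] by blast
    then show "|\<Y> \<beta>| \<le>o |{..<\<mu>}|" using d(3)[OF that] ordLeq_transitive by blast
  qed (auto simp: \<Y>_def)
  then obtain t where t: "\<forall>\<beta><\<kappa>. inj_on (t \<beta>) (\<Y> \<beta>) \<and> (\<forall>X\<in>\<Y> \<beta>. t \<beta> X \<in> dom X)" by metis
  define c where "c \<eta> \<beta> = decode (inv_into (\<Y> \<beta>) (t \<beta>) \<eta>) \<eta>" for \<eta> \<beta>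
  show ?thesis
  proof (rule ontoI[where P = "{..<\<kappa>}" and code = "\<lambda>x. x" and c = c, OF _ _ i0])
    show "c \<eta> \<beta> < \<kappa>" for \<eta> \<beta> by (simp add: c_def decode_less)
  next
    fix B and g :: "'a \<Rightarrow> 'a"
    assume "B \<in> positive {..<\<kappa>} (J_bd \<kappa>)" and "\<forall>u\<in>{..<\<kappa>}. g u < \<kappa>"
    then have B: "B \<subseteq> {..<\<kappa>}" "\<not> bounded_in \<kappa> B" and g: "\<forall>x<\<kappa>. g x < \<kappa>"
      by (auto simp: positive_J_bd)
    have "bij_betw (\<lambda>\<eta>. pr \<eta> (g \<eta>)) {..<\<kappa>} (graph g)"
      unfolding bij_betw_def inj_on_def graph_def using pr_eqD g by blast
    then have "|{..<\<kappa>}| =o |graph g|" using card_of_ordIso by blast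
    then have "|graph g| =o ordr \<kappa>" using c\<kappa> ordIso_symmetric ordIso_transitive by blast
    then have "graph g \<in> subsets_of_card \<kappa> \<kappa>" using graph_subset[OF g] by (simp add: subsets_of_card_def)
    then obtain X where X: "X \<in> \<X>" "X \<subseteq> graph g" using \<X>(3) by blast
    have dX: "\<eta> \<in> dom X \<longleftrightarrow> \<eta> < \<kappa> \<and> pr \<eta> (g \<eta>) \<in> X" for \<eta>
      using pr_mem_graph[OF g] X(2) g by (auto simp: dom_def)
    have cX: "|X| =o |{..<\<mu>}|"
      using \<X>(1) X(1) c\<mu> ordIso_symmetric ordIso_transitive unfolding subsets_of_card_def by blast
    have "X \<subseteq> (\<lambda>\<eta>. pr \<eta> (g \<eta>)) ` dom X"
    proof
      fix x assume "x \<in> X"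
      moreover from this obtain \<eta> where "\<eta> < \<kappa>" "x = pr \<eta> (g \<eta>)" using X(2) by (auto simp: graph_def)
      ultimately show "x \<in> (\<lambda>\<eta>. pr \<eta> (g \<eta>)) ` dom X" using dX by blast
    qed
    then have "|X| \<le>o |dom X|" using card_of_mono1 card_of_image ordLeq_transitive by blast
    then have big: "|{..<\<mu>}| \<le>o |dom X|" using cX ordIso_symmetric ordIso_ordLeq_trans by blast
    have "inj_on (\<lambda>\<eta>. pr \<eta> (g \<eta>)) (dom X)" "(\<lambda>\<eta>. pr \<eta> (g \<eta>)) ` dom X \<subseteq> X"
      using pr_eqD g dX unfolding inj_on_def by blast+
    then have "|dom X| \<le>o |X|" unfolding card_of_ordLeq[symmetric] by blast
    then have "|dom X| <o |{..<\<kappa>}|" using cX d(5) ordLeq_ordIso_trans ordLeq_ordLess_trans by blast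
    moreover have "dom X \<subseteq> {..<\<kappa>}" by (auto simp: dom_def)
    ultimately obtain \<gamma> where \<gamma>: "\<gamma> < \<kappa>" "\<forall>x\<in>dom X. x < \<gamma>"
      using infinite_regularD(3)[OF reg] unfolding bounded_in_def by blast
    have "max \<gamma> (idx X) < \<kappa>" using \<gamma> idx(2) X(1) by auto
    then obtain \<beta> where \<beta>: "\<beta> \<in> B" "max \<gamma> (idx X) < \<beta>" using B(2) unfolding unbounded_iff[OF reg] by blast
    have \<beta>\<kappa>: "\<beta> < \<kappa>" using \<beta> B by auto
    have XY: "X \<in> \<Y> \<beta>" using X(1) big \<beta>(2) \<gamma>(2) by (auto simp: \<Y>_def)
    define \<eta> where "\<eta> = t \<beta> X"
    have \<eta>: "\<eta> \<in> dom X" using t \<beta>\<kappa> XY by (simp add: \<eta>_def)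
    have "inv_into (\<Y> \<beta>) (t \<beta>) \<eta> = X" unfolding \<eta>_def using t \<beta>\<kappa> XY by (intro inv_into_f_f) auto
    then have "c \<eta> \<beta> = g \<eta>" using decode_eq[OF g _ X(2)] \<eta> dX by (simp add: c_def)
    moreover have "\<eta> < \<beta>" using \<eta> \<gamma>(2) \<beta>(2) by auto
    moreover have "\<eta> < \<kappa>" using \<eta> dX by blast
    ultimately show "\<exists>\<eta>\<in>{..<\<kappa>}. \<exists>\<beta>\<in>B. \<eta> < \<beta> \<and> c \<eta> \<beta> = g \<eta>" using \<beta>(1) by blast
  qed auto
qed

text \<open>The injection \<open>f \<beta>\<close> gives every guess at \<beta> its own argument
  below \<beta>. If \<beta> is closed under the map from \<eta> to
  \<open>pr \<eta> (g \<eta>)\<close>, the guess \<open>graph g \<inter> {..<\<beta>}\<close>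
  determines \<open>g\<close> at all arguments below \<beta>, in particular at its own.\<close>

lemma onto_NS_diamond_star:
  fixes \<kappa> :: "'a::wellorder"
  assumes \<kappa>: "regular_uncountable \<kappa>" and ds: "diamond_star \<kappa> {..<\<kappa>}"
  shows "onto \<kappa> {..<\<kappa>} (NS \<kappa>) \<kappa>"
proof -
  note reg = regular_uncountable_regular[OF \<kappa>]
  obtain \<A> where \<A>: "\<forall>\<beta>\<in>{..<\<kappa>}. \<A> \<beta> \<subseteq> Pow {..<\<beta>} \<and> |\<A> \<beta>| \<le>o |{..<\<beta>}|"
    "\<forall>A \<subseteq> {..<\<kappa>}. \<exists>C. club_in \<kappa> C \<and> (\<forall>\<beta> \<in> C \<inter> {..<\<kappa>}. A \<inter> {..<\<beta>} \<in> \<A> \<beta>)"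
    using ds unfolding diamond_star_def by blast
  obtain pr i0 where "pairing \<kappa> pr i0" by (rule exists_pairing[OF reg])
  then interpret pairing \<kappa> pr i0 .
  have "\<forall>\<beta><\<kappa>. \<exists>f. inj_on f (\<A> \<beta>) \<and> f ` \<A> \<beta> \<subseteq> {..<\<beta>}"
    using \<A>(1) unfolding card_of_ordLeq[symmetric] by blast
  then obtain f where f: "\<forall>\<beta><\<kappa>. inj_on (f \<beta>) (\<A> \<beta>) \<and> f \<beta> ` \<A> \<beta> \<subseteq> {..<\<beta>}" by metis
  define c where "c \<eta> \<beta> = decode (inv_into (\<A> \<beta>) (f \<beta>) \<eta>) \<eta>" for \<eta> \<beta>
  show ?thesis
  proof (rule ontoI[where P = "{..<\<kappa>}" and code = "\<lambda>x. x" and c = c, OF _ _ i0])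
    show "c \<eta> \<beta> < \<kappa>" for \<eta> \<beta> by (simp add: c_def decode_less)
  next
    fix B and g :: "'a \<Rightarrow> 'a"
    assume "B \<in> positive {..<\<kappa>} (NS \<kappa>)" and "\<forall>u\<in>{..<\<kappa>}. g u < \<kappa>"
    then have B: "B \<subseteq> {..<\<kappa>}" "stationary_in \<kappa> B" and g: "\<forall>x<\<kappa>. g x < \<kappa>"
      by (auto simp: positive_def NS_def)
    obtain C where C: "club_in \<kappa> C" "\<forall>\<beta> \<in> C \<inter> {..<\<kappa>}. graph g \<inter> {..<\<beta>} \<in> \<A> \<beta>"
      using \<A>(2) graph_subset[OF g] by blast
    obtain \<beta> where \<beta>: "\<beta> \<in> B" "\<beta> < \<kappa>" "i0 < \<beta>" "closed_under (\<lambda>x y z. pr x (g x)) \<beta>" "\<forall>x<\<beta>. \<forall>y<\<beta>. \<beta> \<in> C"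
      by (rule stationary_reflect[OF \<kappa> B(2) i0, of "\<lambda>x y z. pr x (g x)" "\<lambda>x y. C"])
        (use C(1) pr_less g in auto)
    then have A: "graph g \<inter> {..<\<beta>} \<in> \<A> \<beta>" using C(2) by blast
    define \<eta> where "\<eta> = f \<beta> (graph g \<inter> {..<\<beta>})"
    have \<eta>\<beta>: "\<eta> < \<beta>" using f \<beta>(2) A by (auto simp: \<eta>_def)
    then have \<eta>\<kappa>: "\<eta> < \<kappa>" using \<beta>(2) by simp
    have "inv_into (\<A> \<beta>) (f \<beta>) \<eta> = graph g \<inter> {..<\<beta>}"
      unfolding \<eta>_def using f \<beta>(2) A by (intro inv_into_f_f) auto
    moreover have "pr \<eta> (g \<eta>) \<in> graph g \<inter> {..<\<beta>}"
      using pr_graph[OF \<eta>\<kappa>] \<beta>(4) \<eta>\<beta> by (auto simp: closed_under_def)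
    ultimately have "c \<eta> \<beta> = g \<eta>" using decode_eq[OF g \<eta>\<kappa>] by (simp add: c_def)
    then show "\<exists>\<eta>\<in>{..<\<kappa>}. \<exists>\<beta>\<in>B. \<eta> < \<beta> \<and> c \<eta> \<beta> = g \<eta>" using \<beta>(1) \<eta>\<beta> \<eta>\<kappa> by blast
  qed auto
qed

section \<open>Regressive functions with small fibres on nonreflecting sets\<close>

text \<open>A substitute for an injective regressive function: injecting each fibre over \<xi> into
  \<xi> makes \<delta> recoverable from a pair of ordinals below \<delta>. The lower bound \<gamma>
  keeps the values on consecutive intervals apart.\<close>

definition spread :: "'a::wellorder set \<Rightarrow> 'a \<Rightarrow> bool" where
  "spread A \<gamma> \<longleftrightarrow> (\<exists>f. (\<forall>\<delta>\<in>A. \<gamma> \<le> f \<delta> \<and> f \<delta> < \<delta>) \<and> (\<forall>\<xi>. |{\<delta>\<in>A. f \<delta> = \<xi>}| \<le>o |{..<\<xi>}| ))"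

lemma spread_subset:
  assumes "spread A \<gamma>" "A' \<subseteq> A" shows "spread A' \<gamma>"
proof -
  obtain f where f: "\<forall>\<delta>\<in>A. \<gamma> \<le> f \<delta> \<and> f \<delta> < \<delta>" "\<forall>\<xi>. |{\<delta>\<in>A. f \<delta> = \<xi>}| \<le>o |{..<\<xi>}|"
    using assms(1) by (auto simp: spread_def)
  have "|{\<delta>\<in>A'. f \<delta> = \<xi>}| \<le>o |{..<\<xi>}|" for \<xi>
  proof -
    have "{\<delta>\<in>A'. f \<delta> = \<xi>} \<subseteq> {\<delta>\<in>A. f \<delta> = \<xi>}" using assms(2) by auto
    then show ?thesis using f(2) card_of_mono1 ordLeq_transitive by blast
  qed
  then show ?thesis using f(1) assms(2) unfolding spread_def by blast
qed

lemma spread_empty: "spread {} \<gamma>"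
  by (auto simp: spread_def intro: card_of_empty)

text \<open>All of \<open>A'\<close> is sent to \<gamma>; only the fibre over \<gamma> grows, and it
  remains of size at most |\<gamma>| because \<gamma> is infinite.\<close>

lemma spread_Un_small:
  assumes A: "spread A \<gamma>" and inf: "infinite {..<\<gamma>}" and A': "|A'| \<le>o |{..<\<gamma>}|" "\<forall>\<delta>\<in>A'. \<gamma> < \<delta>"
  shows "spread (A \<union> A') \<gamma>"
proof -
  obtain f where f: "\<forall>\<delta>\<in>A. \<gamma> \<le> f \<delta> \<and> f \<delta> < \<delta>" "\<forall>\<xi>. |{\<delta>\<in>A. f \<delta> = \<xi>}| \<le>o |{..<\<xi>}|"
    using A by (auto simp: spread_def)
  define h where "h \<delta> = (if \<delta> \<in> A' then \<gamma> else f \<delta>)" for \<delta>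
  have "|{\<delta>\<in>A \<union> A'. h \<delta> = \<xi>}| \<le>o |{..<\<xi>}|" for \<xi>
  proof (cases "\<xi> = \<gamma>")
    case True
    have "{\<delta>\<in>A \<union> A'. h \<delta> = \<xi>} \<subseteq> {\<delta>\<in>A. f \<delta> = \<xi>} \<union> A'" by (auto simp: h_def)
    moreover have "|{\<delta>\<in>A. f \<delta> = \<xi>} \<union> A'| \<le>o |{..<\<xi>}|"
      using inf f(2) A'(1) True
      by (intro card_of_Un_ordLeq_infinite_Field) (auto simp: Field_card_of card_of_card_order_on)
    ultimately show ?thesis using card_of_mono1 ordLeq_transitive by blast
  next
    case False
    then have "{\<delta>\<in>A \<union> A'. h \<delta> = \<xi>} \<subseteq> {\<delta>\<in>A. f \<delta> = \<xi>}" by (auto simp: h_def)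
    then show ?thesis using f(2) card_of_mono1 ordLeq_transitive by blast
  qed
  moreover have "\<forall>\<delta>\<in>A \<union> A'. \<gamma> \<le> h \<delta> \<and> h \<delta> < \<delta>" using f(1) A'(2) by (auto simp: h_def)
  ultimately show ?thesis unfolding spread_def by blast
qed

text \<open>Values on \<open>A k\<close> are at least \<open>a k\<close> and below the respective
  argument, so by \<open>disj\<close> different pieces share no value and every fibre lies in a
  single piece.\<close>

lemma spread_UN:
  assumes A: "\<forall>k\<in>K. spread (A k) (a k) \<and> \<gamma> \<le> a k"
    and disj: "\<And>k k' \<delta> \<delta>'. k \<in> K \<Longrightarrow> k' \<in> K \<Longrightarrow> k \<noteq> k' \<Longrightarrow> \<delta> \<in> A k \<Longrightarrow> \<delta>' \<in> A k' \<Longrightarrow> \<delta> \<le> a k' \<or> \<delta>' \<le> a k"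
  shows "spread (\<Union>k\<in>K. A k) \<gamma>"
proof -
  have "\<forall>k\<in>K. \<exists>f. (\<forall>\<delta>\<in>A k. a k \<le> f \<delta> \<and> f \<delta> < \<delta>) \<and> (\<forall>\<xi>. |{\<delta>\<in>A k. f \<delta> = \<xi>}| \<le>o |{..<\<xi>}| )"
    using A by (simp add: spread_def)
  then obtain F where F: "\<forall>k\<in>K. (\<forall>\<delta>\<in>A k. a k \<le> F k \<delta> \<and> F k \<delta> < \<delta>) \<and> (\<forall>\<xi>. |{\<delta>\<in>A k. F k \<delta> = \<xi>}| \<le>o |{..<\<xi>}| )"
    by metis
  define k where "k \<delta> = (SOME k. k \<in> K \<and> \<delta> \<in> A k)" for \<delta>
  have k: "k \<delta> \<in> K \<and> \<delta> \<in> A (k \<delta>)" if "\<delta> \<in> (\<Union>k\<in>K. A k)" for \<delta>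
    unfolding k_def by (rule someI_ex) (use that in auto)
  define h where "h \<delta> = F (k \<delta>) \<delta>" for \<delta>
  have h: "a (k \<delta>) \<le> h \<delta> \<and> h \<delta> < \<delta> \<and> \<gamma> \<le> a (k \<delta>)" if "\<delta> \<in> (\<Union>k\<in>K. A k)" for \<delta>
    using F k[OF that] A by (auto simp: h_def)
  have "|{\<delta>\<in>(\<Union>k\<in>K. A k). h \<delta> = \<xi>}| \<le>o |{..<\<xi>}|" for \<xi>
  proof (cases "{\<delta>\<in>(\<Union>k\<in>K. A k). h \<delta> = \<xi>} = {}")
    case True
    then show ?thesis by (simp only: True card_of_empty)
  next
    case False
    then obtain \<delta>0 where \<delta>0: "\<delta>0 \<in> (\<Union>k\<in>K. A k)" "h \<delta>0 = \<xi>" by blast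
    have "{\<delta>\<in>(\<Union>k\<in>K. A k). h \<delta> = \<xi>} \<subseteq> {\<delta>\<in>A (k \<delta>0). F (k \<delta>0) \<delta> = \<xi>}"
    proof
      fix \<delta> assume "\<delta> \<in> {\<delta>\<in>(\<Union>k\<in>K. A k). h \<delta> = \<xi>}"
      then have \<delta>: "\<delta> \<in> (\<Union>k\<in>K. A k)" "h \<delta> = \<xi>" by auto
      have "k \<delta> = k \<delta>0"
      proof (rule ccontr)
        assume "k \<delta> \<noteq> k \<delta>0"
        then have "\<delta> \<le> a (k \<delta>0) \<or> \<delta>0 \<le> a (k \<delta>)" using disj k[OF \<delta>(1)] k[OF \<delta>0(1)] by blast
        then show False using h[OF \<delta>(1)] h[OF \<delta>0(1)] \<delta>(2) \<delta>0(2) by auto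
      qed
      then show "\<delta> \<in> {\<delta>\<in>A (k \<delta>0). F (k \<delta>0) \<delta> = \<xi>}" using k[OF \<delta>(1)] \<delta>(2) by (auto simp: h_def)
    qed
    moreover have "|{\<delta>\<in>A (k \<delta>0). F (k \<delta>0) \<delta> = \<xi>}| \<le>o |{..<\<xi>}|" using F k[OF \<delta>0(1)] by blast
    ultimately show ?thesis using card_of_mono1 ordLeq_transitive by blast
  qed
  moreover have "\<forall>\<delta>\<in>(\<Union>k\<in>K. A k). \<gamma> \<le> h \<delta> \<and> h \<delta> < \<delta>" using h by (auto intro: order_trans)
  ultimately show ?thesis unfolding spread_def by blast
qed

text \<open>Here \<beta> need not be a cardinal: |A| is shorter than \<beta> as a well-order, hence
  isomorphic to a proper initial segment.\<close>

lemma card_of_less_lessThan: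
  fixes \<beta> :: "'a::wellorder"
  assumes "|A| <o |{..<\<beta>}|"
  obtains a where "a < \<beta>" "|A| \<le>o |{..<a}|"
proof -
  have "|{..<\<beta>}| \<le>o ordr \<beta>"
    using card_of_least[of "{..<\<beta>}" "ordr \<beta>"] Well_order_ordr[of \<beta>] by simp
  then have "|A| <o ordr \<beta>" using assms ordLess_ordLeq_trans by blast
  then obtain a where a: "a < \<beta>" and iso: "|A| =o Restr (ordr \<beta>) (underS (ordr \<beta>) a)"
    using ordLess_iff_ordIso_Restr[OF Well_order_ordr card_of_Well_order] by auto
  have R: "Restr (ordr \<beta>) (underS (ordr \<beta>) a) = ordr a"
    unfolding underS_ordr[OF a] using a by (auto simp: ordr_def)
  have "|Field |A| | =o |{..<a}|" using card_of_cong[OF iso[unfolded R]] by simp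
  then have "|A| \<le>o |{..<a}|" by (simp add: Field_card_of ordIso_imp_ordLeq)
  then show ?thesis using that a by blast
qed

definition acc_pt :: "'a::wellorder set \<Rightarrow> 'a \<Rightarrow> bool" where
  "acc_pt K \<delta> \<longleftrightarrow> K \<inter> {..<\<delta>} \<noteq> {} \<and> (\<forall>\<alpha><\<delta>. \<exists>x\<in>K \<inter> {..<\<delta>}. \<alpha> < x)"

text \<open>Sending \<delta> to the least member of \<open>K\<close> that is at least \<delta> is
  strictly increasing on accumulation points, since a member of \<open>K\<close> lies between any
  two of them.\<close>

lemma card_of_acc_pt:
  fixes \<beta> :: "'a::wellorder"
  assumes cof: "\<forall>x<\<beta>. \<exists>k\<in>K. x \<le> k"
  shows "|{\<delta>. \<delta> < \<beta> \<and> acc_pt K \<delta>}| \<le>o |K|"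
proof -
  define m where "m \<delta> = (LEAST k. k \<in> K \<and> \<delta> \<le> k)" for \<delta>
  have m: "m \<delta> \<in> K \<and> \<delta> \<le> m \<delta>" if "\<delta> < \<beta>" for \<delta>
    unfolding m_def by (rule LeastI_ex) (use cof that in blast)
  have "m x < m y" if xy: "x < y" "y < \<beta>" "acc_pt K y" for x y
  proof -
    obtain k where "k \<in> K" "k < y" "x < k" using xy unfolding acc_pt_def by blast
    then have "m x \<le> k" unfolding m_def by (intro Least_le) auto
    then show ?thesis using m[OF xy(2)] \<open>k < y\<close> by auto
  qed
  then have "inj_on m {\<delta>. \<delta> < \<beta> \<and> acc_pt K \<delta>}"
    by (intro linorder_inj_onI) (auto simp: less_le)
  moreover have "m ` {\<delta>. \<delta> < \<beta> \<and> acc_pt K \<delta>} \<subseteq> K" using m by auto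
  ultimately show ?thesis unfolding card_of_ordLeq[symmetric] by blast
qed

text \<open>A cofinal subset \<open>K\<close> of \<open>\<beta>\<close> cuts \<open>\<beta>\<close> into intervals to which the induction hypothesis applies.
  Only the accumulation points of \<open>K\<close> lying in \<open>T\<close> are left over: there are few of them if \<open>\<beta>\<close> is singular,
  and none if \<open>\<beta>\<close> is regular and \<open>K\<close> is a club missing \<open>T\<close>.\<close>
lemma spread_nonreflecting:
  fixes \<kappa> :: "'a::wellorder"
  assumes nr: "\<not> reflects_at_regulars \<kappa> T"
  shows "\<beta> < \<kappa> \<Longrightarrow> \<gamma> < \<beta> \<Longrightarrow> infinite {..<\<gamma>} \<Longrightarrow> spread (T \<inter> {\<gamma><..<\<beta>}) \<gamma>"
proof (induction \<beta> arbitrary: \<gamma> rule: less_induct)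
  case (less \<beta>)
  have IH: "spread (T \<inter> {\<gamma>'<..\<beta>'}) \<gamma>'" if "\<gamma>' < \<beta>'" "\<beta>' < \<beta>" "infinite {..<\<gamma>'}" for \<gamma>' \<beta>'
  proof -
    have "spread (T \<inter> {\<gamma>'<..<\<beta>'}) \<gamma>'" using less.IH[of \<beta>' \<gamma>'] that less.prems(1) by simp
    moreover have "|{\<beta>'}| \<le>o |{..<\<gamma>'}|"
      using that(3) finite_card_less_infinite[of "{\<beta>'}" "{..<\<gamma>'}"] ordLess_imp_ordLeq by blast
    ultimately have "spread (T \<inter> {\<gamma>'<..<\<beta>'} \<union> {\<beta>'}) \<gamma>'"
      using that by (intro spread_Un_small) auto
    then show ?thesis by (rule spread_subset) auto
  qed
  have inf_ge: "infinite {..<x}" if "\<gamma> \<le> x" for x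
    using less.prems(3) that finite_subset[of "{..<\<gamma>}" "{..<x}"] by fastforce
  \<comment> \<open>The lower end may be raised to \<gamma>1: the induction hypothesis handles the
    points up to \<gamma>1, and the two intervals are glued.\<close>
  have reduce: "spread (T \<inter> {\<gamma><..<\<beta>}) \<gamma>" if \<gamma>1: "\<gamma> \<le> \<gamma>1" "\<gamma>1 < \<beta>" and sp: "spread (T \<inter> {\<gamma>1<..<\<beta>}) \<gamma>1" for \<gamma>1
  proof (cases "\<gamma> = \<gamma>1")
    case True
    then show ?thesis using sp by simp
  next
    case False
    then have g: "\<gamma> < \<gamma>1" using \<gamma>1 by simp
    define A where "A b = (if b then T \<inter> {\<gamma><..\<gamma>1} else T \<inter> {\<gamma>1<..<\<beta>})" for b
    define a where "a b = (if b then \<gamma> else \<gamma>1)" for b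
    have "spread (\<Union>b\<in>UNIV. A b) \<gamma>"
    proof (rule spread_UN[where a = a])
      show "\<forall>b\<in>UNIV. spread (A b) (a b) \<and> \<gamma> \<le> a b"
        using IH[OF g \<gamma>1(2) less.prems(3)] sp \<gamma>1(1) by (simp add: A_def a_def)
    qed (auto simp: A_def a_def split: if_splits)
    then show ?thesis by (rule spread_subset) (auto simp: A_def)
  qed
  show ?case
  proof (cases "\<exists>\<gamma>'<\<beta>. |{..<\<beta>}| \<le>o |{..<\<gamma>'}|")
    case True
    then obtain \<gamma>' where \<gamma>': "\<gamma>' < \<beta>" "|{..<\<beta>}| \<le>o |{..<\<gamma>'}|" by blast
    define \<gamma>1 where "\<gamma>1 = max \<gamma> \<gamma>'"
    have "|{..<\<gamma>'}| \<le>o |{..<\<gamma>1}|" by (rule card_of_lessThan_mono) (simp add: \<gamma>1_def)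
    moreover have "|T \<inter> {\<gamma>1<..<\<beta>}| \<le>o |{..<\<beta>}|" by (rule card_of_mono1) auto
    ultimately have "|T \<inter> {\<gamma>1<..<\<beta>}| \<le>o |{..<\<gamma>1}|" using \<gamma>'(2) ordLeq_transitive by blast
    \<comment> \<open>If \<beta> is not a cardinal, the interval above \<gamma>1 has at most
      |\<gamma>1| points and can be sent to \<gamma>1 as a whole.\<close>
    then have "spread ({} \<union> T \<inter> {\<gamma>1<..<\<beta>}) \<gamma>1"
      by (intro spread_Un_small spread_empty inf_ge) (auto simp: \<gamma>1_def)
    then show ?thesis using \<gamma>' less.prems by (intro reduce[of \<gamma>1]) (auto simp: \<gamma>1_def)
  next
    case False
    then have card: "\<forall>\<gamma>'<\<beta>. |{..<\<gamma>'}| <o |{..<\<beta>}|"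
      using not_ordLeq_iff_ordLess[OF card_of_Well_order card_of_Well_order] by blast
    have "\<exists>K \<gamma>1. \<gamma> \<le> \<gamma>1 \<and> \<gamma>1 < \<beta> \<and> K \<subseteq> {..<\<beta>} \<and> (\<forall>x<\<beta>. \<exists>k\<in>K. x \<le> k) \<and>
      |{\<delta>\<in>T. \<gamma>1 < \<delta> \<and> \<delta> < \<beta> \<and> acc_pt K \<delta>}| \<le>o |{..<\<gamma>1}|"
    proof (cases "infinite_regular \<beta>")
      case True
      have "uncountable {..<\<beta>}"
      proof
        assume "countable {..<\<beta>}"
        then obtain f :: "'a \<Rightarrow> nat" where "inj_on f {..<\<beta>}" unfolding countable_def by blast
        then have "|{..<\<beta>}| \<le>o |UNIV::nat set|" by (auto simp: card_of_ordLeq[symmetric])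
        also have "|UNIV::nat set| \<le>o |{..<\<gamma>}|" using less.prems(3) infinite_iff_card_of_nat by blast
        finally show False using card less.prems(2) not_ordLess_ordLeq by blast
      qed
      then have "regular_uncountable \<beta>" using True by (simp add: regular_uncountable_def)
      then have "\<not> stationary_in \<beta> (T \<inter> {..<\<beta>})"
        using nr less.prems(1) unfolding reflects_at_regulars_def by blast
      then obtain C where C: "club_in \<beta> C" "T \<inter> {..<\<beta>} \<inter> C = {}" unfolding stationary_in_def by auto
      have "\<delta> \<in> C" if "\<delta> < \<beta>" "acc_pt C \<delta>" for \<delta>
        using C(1) that unfolding club_in_def acc_pt_def by blast
      then have "{\<delta>\<in>T. \<gamma> < \<delta> \<and> \<delta> < \<beta> \<and> acc_pt C \<delta>} = {}" using C(2) by blast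
      then have "|{\<delta>\<in>T. \<gamma> < \<delta> \<and> \<delta> < \<beta> \<and> acc_pt C \<delta>}| \<le>o |{..<\<gamma>}|" by (simp only: card_of_empty)
      moreover have "C \<subseteq> {..<\<beta>}" "\<forall>x<\<beta>. \<exists>k\<in>C. x \<le> k" using C(1) less_imp_le unfolding club_in_def by blast+
      ultimately show ?thesis
        using less.prems(2) by (intro exI[of _ C] exI[of _ \<gamma>]) simp
    next
      case False
      then obtain K where K: "K \<subseteq> {..<\<beta>}" "|K| <o |{..<\<beta>}|" "\<not> bounded_in \<beta> K"
        using card inf_ge[of \<beta>] less.prems(2) unfolding infinite_regular_iff by auto
      have cof: "\<forall>x<\<beta>. \<exists>k\<in>K. x \<le> k" using K(3) unfolding bounded_in_def by (meson not_less)
      obtain \<gamma>' where \<gamma>': "\<gamma>' < \<beta>" "|K| \<le>o |{..<\<gamma>'}|" by (rule card_of_less_lessThan[OF K(2)])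
      define \<gamma>1 where "\<gamma>1 = max \<gamma> \<gamma>'"
      have "|{..<\<gamma>'}| \<le>o |{..<\<gamma>1}|" by (rule card_of_lessThan_mono) (simp add: \<gamma>1_def)
      moreover have "|{\<delta>\<in>T. \<gamma>1 < \<delta> \<and> \<delta> < \<beta> \<and> acc_pt K \<delta>}| \<le>o |{\<delta>. \<delta> < \<beta> \<and> acc_pt K \<delta>}|"
        by (rule card_of_mono1) auto
      ultimately have "|{\<delta>\<in>T. \<gamma>1 < \<delta> \<and> \<delta> < \<beta> \<and> acc_pt K \<delta>}| \<le>o |{..<\<gamma>1}|"
        using card_of_acc_pt[OF cof] \<gamma>'(2) ordLeq_transitive by blast
      then show ?thesis
        using K(1) cof \<gamma>'(1) less.prems(2) by (intro exI[of _ K] exI[of _ \<gamma>1]) (auto simp: \<gamma>1_def)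
    qed
    then obtain K \<gamma>1 where \<gamma>1: "\<gamma> \<le> \<gamma>1" "\<gamma>1 < \<beta>" and K: "K \<subseteq> {..<\<beta>}" "\<forall>x<\<beta>. \<exists>k\<in>K. x \<le> k"
      and few: "|{\<delta>\<in>T. \<gamma>1 < \<delta> \<and> \<delta> < \<beta> \<and> acc_pt K \<delta>}| \<le>o |{..<\<gamma>1}|" by blast
    define m where "m \<delta> = (LEAST k. k \<in> K \<and> \<delta> \<le> k)" for \<delta>
    have m: "m \<delta> \<in> K \<and> \<delta> \<le> m \<delta>" if "\<delta> < \<beta>" for \<delta>
      unfolding m_def by (rule LeastI_ex) (use K(2) that in blast)
    have m_least: "m \<delta> \<le> k" if "k \<in> K" "\<delta> \<le> k" for \<delta> k
      unfolding m_def using that by (intro Least_le) auto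
    define A where "A k = {\<delta>\<in>T. \<gamma>1 < \<delta> \<and> \<delta> < \<beta> \<and> \<not> acc_pt K \<delta> \<and> m \<delta> = k}" for k
    \<comment> \<open>The supremum of \<gamma>1 and the members of \<open>K\<close> below
      \<open>k\<close>, that is, the left end of the interval of \<open>K\<close> ending at
      \<open>k\<close>.\<close>
    define a where "a k = (LEAST a. \<gamma>1 \<le> a \<and> (\<forall>x\<in>K. x < k \<longrightarrow> x \<le> a))" for k
    have a: "\<gamma>1 \<le> a k \<and> (\<forall>x\<in>K. x < k \<longrightarrow> x \<le> a k)" for k
      unfolding a_def by (rule LeastI[of _ "max \<gamma>1 k"]) (auto simp: le_max_iff_disj)
    have a_less: "a k < \<delta> \<and> \<delta> \<le> k" if \<delta>: "\<delta> \<in> A k" for k \<delta>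
    proof -
      have \<delta>': "\<gamma>1 < \<delta>" "\<delta> < \<beta>" "\<not> acc_pt K \<delta>" "m \<delta> = k" using \<delta> by (auto simp: A_def)
      have below: "x < \<delta>" if "x \<in> K" "x < k" for x
        using m_least[of x \<delta>] that \<delta>'(4) by (meson not_less)
      \<comment> \<open>Since \<delta> is no accumulation point of \<open>K\<close>, the members of
        \<open>K\<close> below \<delta> have a bound below \<delta>; this is why \<open>a k\<close>
        stays strictly below \<delta>.\<close>
      obtain \<alpha> where \<alpha>: "\<alpha> < \<delta>" "\<forall>x\<in>K. x < \<delta> \<longrightarrow> x \<le> \<alpha>"
      proof (cases "K \<inter> {..<\<delta>} = {}")
        case True
        then show ?thesis using that[of \<gamma>1] \<delta>'(1) by blast
      next
        case False
        then obtain \<alpha> where "\<alpha> < \<delta>" "\<forall>x\<in>K \<inter> {..<\<delta>}. \<not> \<alpha> < x" using \<delta>'(3) unfolding acc_pt_def by blast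
        then show ?thesis using that[of \<alpha>] by (simp add: not_less)
      qed
      have "a k \<le> max \<gamma>1 \<alpha>"
        unfolding a_def by (rule Least_le) (use below \<alpha> in \<open>auto simp: le_max_iff_disj\<close>)
      then have "a k < \<delta>" using \<alpha>(1) \<delta>'(1) by (meson max_less_iff_conj order_le_less_trans)
      then show ?thesis using m[OF \<delta>'(2)] \<delta>'(4) by auto
    qed
    have "spread (\<Union>k\<in>K. A k) \<gamma>1"
    proof (rule spread_UN[where a = a])
      show "\<forall>k\<in>K. spread (A k) (a k) \<and> \<gamma>1 \<le> a k"
      proof (intro ballI conjI)
        fix k assume k: "k \<in> K"
        show "\<gamma>1 \<le> a k" using a by blast
        show "spread (A k) (a k)"
        proof (cases "A k = {}")
          case True
          then show ?thesis by (simp add: spread_empty)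
        next
          case False
          then have "a k < k" using a_less by fastforce
          moreover have "k < \<beta>" using K(1) k by auto
          moreover have "infinite {..<a k}" using a \<gamma>1(1) by (intro inf_ge) (auto intro: order_trans)
          ultimately have "spread (T \<inter> {a k<..k}) (a k)" by (rule IH)
          then show ?thesis by (rule spread_subset) (use a_less in \<open>auto simp: A_def\<close>)
        qed
      qed
    next
      fix k k' \<delta> \<delta>' assume k: "k \<in> K" "k' \<in> K" "k \<noteq> k'" and "\<delta> \<in> A k" "\<delta>' \<in> A k'"
      then have "\<delta> \<le> k" "\<delta>' \<le> k'" using a_less by blast+
      moreover have "k < k' \<or> k' < k" using k by auto
      ultimately show "\<delta> \<le> a k' \<or> \<delta>' \<le> a k" using a k by (meson order_trans)
    qed
    then have "spread ((\<Union>k\<in>K. A k) \<union> {\<delta>\<in>T. \<gamma>1 < \<delta> \<and> \<delta> < \<beta> \<and> acc_pt K \<delta>}) \<gamma>1"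
      using few \<gamma>1(1) by (intro spread_Un_small inf_ge) auto
    then have "spread (T \<inter> {\<gamma>1<..<\<beta>}) \<gamma>1"
      by (rule spread_subset) (use m in \<open>auto simp: A_def\<close>)
    then show ?thesis by (rule reduce[OF \<gamma>1])
  qed
qed

section \<open>Diamond on a nonreflecting set\<close>

lemma exists_infinite_below:
  fixes \<kappa> :: "'a::wellorder"
  assumes \<kappa>: "regular_uncountable \<kappa>"
  obtains \<gamma> where "\<gamma> < \<kappa>" "infinite {..<\<gamma>}"
proof -
  have "infinite {..<\<kappa>}" using infinite_regularD(1)[OF regular_uncountable_regular[OF \<kappa>]] .
  then obtain a :: "nat \<Rightarrow> 'a" where a: "inj a" "range a \<subseteq> {..<\<kappa>}"
    using infinite_countable_subset by blast
  then obtain \<gamma> where \<gamma>: "\<gamma> < \<kappa>" "\<forall>n. a n < \<gamma>" using regular_uncountable_nat_bound[OF \<kappa>, of a] by blast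
  then have "range a \<subseteq> {..<\<gamma>}" by auto
  then have "infinite {..<\<gamma>}" using a(1) range_inj_infinite infinite_super by blast
  then show ?thesis using that \<gamma>(1) by blast
qed

text \<open>For each \<beta>, distinct guessing points \<delta> below \<beta> own distinct arguments
  \<open>t \<beta> \<delta>\<close>. A \<delta> that guesses the graph of \<open>g\<close> and is
  closed under the coding has its argument below \<delta>, where the guess already determines
  \<open>g\<close>; hence every \<beta> above \<delta> works.\<close>

lemma onto_J_bd_diamond:
  fixes \<kappa> :: "'a::wellorder"
  assumes \<kappa>: "regular_uncountable \<kappa>" and nr: "\<not> reflects_at_regulars \<kappa> T" and dia: "diamond \<kappa> T"
  shows "onto \<kappa> {..<\<kappa>} (J_bd \<kappa>) \<kappa>"
proof -
  note reg = regular_uncountable_regular[OF \<kappa>]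
  obtain D where D: "\<forall>A \<subseteq> {..<\<kappa>}. stationary_in \<kappa> {\<beta>\<in>T. A \<inter> {..<\<beta>} = D \<beta>}"
    using dia unfolding diamond_def by blast
  obtain pr i0 where "pairing \<kappa> pr i0" by (rule exists_pairing[OF reg])
  then interpret pairing \<kappa> pr i0 .
  obtain \<gamma>0 where \<gamma>0: "\<gamma>0 < \<kappa>" "infinite {..<\<gamma>0}" by (rule exists_infinite_below[OF \<kappa>])
  \<comment> \<open>Not every \<delta> is closed under \<open>pr\<close>, so only a code of a pair
    from below \<delta> is asked for; it falls below \<delta> at the closed points used
    later.\<close>
  have "\<exists>t. inj_on t (T \<inter> {\<gamma>0<..<\<beta>}) \<and> (\<forall>\<delta>\<in>T \<inter> {\<gamma>0<..<\<beta>}. \<exists>x<\<delta>. \<exists>y<\<delta>. t \<delta> = pr x y)"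
    if \<beta>: "\<beta> < \<kappa>" for \<beta>
  proof -
    have "spread (T \<inter> {\<gamma>0<..<\<beta>}) \<gamma>0"
    proof (cases "\<gamma>0 < \<beta>")
      case True
      then show ?thesis using spread_nonreflecting[OF nr \<beta>] \<gamma>0(2) by blast
    next
      case False
      then have "T \<inter> {\<gamma>0<..<\<beta>} = {}" by auto
      then show ?thesis by (simp only: spread_empty)
    qed
    then obtain f where f: "\<forall>\<delta>\<in>T \<inter> {\<gamma>0<..<\<beta>}. \<gamma>0 \<le> f \<delta> \<and> f \<delta> < \<delta>"
      "\<forall>\<xi>. |{\<delta>\<in>T \<inter> {\<gamma>0<..<\<beta>}. f \<delta> = \<xi>}| \<le>o |{..<\<xi>}|" by (auto simp: spread_def)
    then have "\<forall>\<xi>. \<exists>e. inj_on e {\<delta>\<in>T \<inter> {\<gamma>0<..<\<beta>}. f \<delta> = \<xi>} \<and> e ` {\<delta>\<in>T \<inter> {\<gamma>0<..<\<beta>}. f \<delta> = \<xi>} \<subseteq> {..<\<xi>}"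
      unfolding card_of_ordLeq[symmetric] by blast
    from choice[OF this] obtain e where e: "\<forall>\<xi>. inj_on (e \<xi>) {\<delta>\<in>T \<inter> {\<gamma>0<..<\<beta>}. f \<delta> = \<xi>} \<and> e \<xi> ` {\<delta>\<in>T \<inter> {\<gamma>0<..<\<beta>}. f \<delta> = \<xi>} \<subseteq> {..<\<xi>}"
      by (rule exE)
    have le: "f \<delta> < \<delta>" "e (f \<delta>) \<delta> < \<delta>" "\<delta> < \<kappa>" if "\<delta> \<in> T \<inter> {\<gamma>0<..<\<beta>}" for \<delta>
    proof -
      show 1: "f \<delta> < \<delta>" using f(1) that by blast
      have "e (f \<delta>) \<delta> < f \<delta>" using e that by blast
      then show "e (f \<delta>) \<delta> < \<delta>" using 1 by simp
      show "\<delta> < \<kappa>" using that \<beta> by auto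
    qed
    define t where "t \<delta> = pr (f \<delta>) (e (f \<delta>) \<delta>)" for \<delta>
    have "inj_on t (T \<inter> {\<gamma>0<..<\<beta>})"
    proof (rule inj_onI)
      fix x y assume xy: "x \<in> T \<inter> {\<gamma>0<..<\<beta>}" "y \<in> T \<inter> {\<gamma>0<..<\<beta>}" "t x = t y"
      have "f x = f y \<and> e (f x) x = e (f y) y"
        using xy(3) le[OF xy(1)] le[OF xy(2)] unfolding t_def by (intro pr_eqD) auto
      moreover have "inj_on (e (f y)) {\<delta>\<in>T \<inter> {\<gamma>0<..<\<beta>}. f \<delta> = f y}" using e by blast
      ultimately show "x = y" using xy(1,2) by (intro inj_onD[of "e (f y)" "{\<delta>\<in>T \<inter> {\<gamma>0<..<\<beta>}. f \<delta> = f y}" x y]) auto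
    qed
    moreover have "\<exists>x<\<delta>. \<exists>y<\<delta>. t \<delta> = pr x y" if "\<delta> \<in> T \<inter> {\<gamma>0<..<\<beta>}" for \<delta>
      using le[OF that] by (auto simp: t_def)
    ultimately show ?thesis by blast
  qed
  then obtain t where t: "\<forall>\<beta><\<kappa>. inj_on (t \<beta>) (T \<inter> {\<gamma>0<..<\<beta>}) \<and> (\<forall>\<delta>\<in>T \<inter> {\<gamma>0<..<\<beta>}. \<exists>x<\<delta>. \<exists>y<\<delta>. t \<beta> \<delta> = pr x y)"
    by metis
  define c where "c \<eta> \<beta> = decode (D (inv_into (T \<inter> {\<gamma>0<..<\<beta>}) (t \<beta>) \<eta>)) \<eta>" for \<eta> \<beta>
  show ?thesis
  proof (rule ontoI[where P = "{..<\<kappa>}" and code = "\<lambda>x. x" and c = c, OF _ _ i0])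
    show "c \<eta> \<beta> < \<kappa>" for \<eta> \<beta> by (simp add: c_def decode_less)
  next
    fix B and g :: "'a \<Rightarrow> 'a"
    assume "B \<in> positive {..<\<kappa>} (J_bd \<kappa>)" and "\<forall>u\<in>{..<\<kappa>}. g u < \<kappa>"
    then have B: "B \<subseteq> {..<\<kappa>}" "\<not> bounded_in \<kappa> B" and g: "\<forall>x<\<kappa>. g x < \<kappa>"
      by (auto simp: positive_J_bd)
    have st: "stationary_in \<kappa> {\<beta>\<in>T. graph g \<inter> {..<\<beta>} = D \<beta>}" using D graph_subset[OF g] by blast
    obtain \<delta> where \<delta>: "\<delta> \<in> {\<beta>\<in>T. graph g \<inter> {..<\<beta>} = D \<beta>}" "\<delta> < \<kappa>" "\<gamma>0 < \<delta>"
      "closed_under (\<lambda>x y z. max (pr x y) (pr x (g x))) \<delta>"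
      by (rule stationary_reflect[OF \<kappa> st \<gamma>0(1), of "\<lambda>x y z. max (pr x y) (pr x (g x))" "\<lambda>x y. {..<\<kappa>}"])
        (use club_UNIV[OF reg] pr_less g in auto)
    have cl: "pr x y < \<delta>" "pr x (g x) < \<delta>" if "x < \<delta>" "y < \<delta>" for x y
      using \<delta>(4) that unfolding closed_under_def by auto
    obtain \<beta> where \<beta>: "\<beta> \<in> B" "\<delta> < \<beta>" using B(2) \<delta>(2) unfolding unbounded_iff[OF reg] by blast
    have \<beta>\<kappa>: "\<beta> < \<kappa>" using \<beta> B by auto
    have T\<delta>: "\<delta> \<in> T \<inter> {\<gamma>0<..<\<beta>}" using \<delta> \<beta> by auto
    define \<eta> where "\<eta> = t \<beta> \<delta>"
    have "\<exists>x<\<delta>. \<exists>y<\<delta>. \<eta> = pr x y" using t \<beta>\<kappa> T\<delta> unfolding \<eta>_def by blast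
    then have \<eta>\<delta>: "\<eta> < \<delta>" using cl(1) by auto
    then have \<eta>: "\<eta> < \<kappa>" "\<eta> < \<beta>" using \<delta>(2) \<beta>(2) by auto
    have "inv_into (T \<inter> {\<gamma>0<..<\<beta>}) (t \<beta>) \<eta> = \<delta>" unfolding \<eta>_def using t \<beta>\<kappa> T\<delta> by (intro inv_into_f_f) auto
    moreover have "pr \<eta> (g \<eta>) \<in> graph g \<inter> {..<\<delta>}" using pr_graph[OF \<eta>(1)] cl(2)[OF \<eta>\<delta> \<eta>\<delta>] by auto
    moreover have "D \<delta> = graph g \<inter> {..<\<delta>}" using \<delta>(1) by auto
    ultimately have "c \<eta> \<beta> = g \<eta>" using decode_eq[OF g \<eta>(1)] by (simp add: c_def)
    then show "\<exists>\<eta>\<in>{..<\<kappa>}. \<exists>\<beta>\<in>B. \<eta> < \<beta> \<and> c \<eta> \<beta> = g \<eta>" using \<beta>(1) \<eta> by blast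
  qed auto
qed

theorem theoremC:
  fixes \<kappa> :: "'a::wellorder"
  shows
    "(uncountable_succ_cardinal \<kappa> \<longrightarrow>
        (\<forall>\<theta><\<kappa>. infinite_regular \<theta> \<longrightarrow> onto \<kappa> {..<\<kappa>} (J_bd \<kappa>) \<theta>) \<and>
        (stick \<kappa> \<longrightarrow> onto \<kappa> {..<\<kappa>} (J_bd \<kappa>) \<kappa>))
     \<and>
     (regular_uncountable \<kappa> \<longrightarrow>
        (\<forall>S. stationary_in \<kappa> S \<longrightarrow>
           (\<exists>S' \<subseteq> S. stationary_in \<kappa> S' \<and>
              (\<forall>\<theta><\<kappa>. infinite_regular \<theta> \<longrightarrow> onto \<kappa> S' (NS_restr \<kappa> S') \<theta>))))
     \<and>
     (regular_uncountable \<kappa> \<longrightarrow>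
        diamond_star \<kappa> {..<\<kappa>} \<longrightarrow> onto \<kappa> {..<\<kappa>} (NS \<kappa>) \<kappa>)
     \<and>
     (regular_uncountable \<kappa> \<longrightarrow>
        (\<exists>T. stationary_in \<kappa> T \<and> \<not> reflects_at_regulars \<kappa> T \<and> diamond \<kappa> T) \<longrightarrow>
        onto \<kappa> {..<\<kappa>} (J_bd \<kappa>) \<kappa>)"
proof (intro conjI impI allI)
  fix \<theta> :: 'a
  assume "uncountable_succ_cardinal \<kappa>" "\<theta> < \<kappa>" "infinite_regular \<theta>"
  then show "onto \<kappa> {..<\<kappa>} (J_bd \<kappa>) \<theta>"
    unfolding uncountable_succ_cardinal_def using onto_J_bd_succ by blast
next
  assume "uncountable_succ_cardinal \<kappa>" "stick \<kappa>"
  then show "onto \<kappa> {..<\<kappa>} (J_bd \<kappa>) \<kappa>"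
    unfolding uncountable_succ_cardinal_def using onto_J_bd_stick by blast
next
  fix S assume "regular_uncountable \<kappa>" "stationary_in \<kappa> S"
  then obtain S' where "S' \<subseteq> S" "stationary_in \<kappa> S'"
    "\<forall>\<theta><\<kappa>. infinite_regular \<theta> \<longrightarrow> onto \<kappa> S' (NS_restr \<kappa> S') \<theta>"
    by (rule onto_NS_restr)
  then show "\<exists>S' \<subseteq> S. stationary_in \<kappa> S' \<and>
      (\<forall>\<theta><\<kappa>. infinite_regular \<theta> \<longrightarrow> onto \<kappa> S' (NS_restr \<kappa> S') \<theta>)"
    by blast
next
  assume "regular_uncountable \<kappa>" "diamond_star \<kappa> {..<\<kappa>}"
  then show "onto \<kappa> {..<\<kappa>} (NS \<kappa>) \<kappa>" by (rule onto_NS_diamond_star)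
next
  assume "regular_uncountable \<kappa>"
    and "\<exists>T. stationary_in \<kappa> T \<and> \<not> reflects_at_regulars \<kappa> T \<and> diamond \<kappa> T"
  then show "onto \<kappa> {..<\<kappa>} (J_bd \<kappa>) \<kappa>" using onto_J_bd_diamond by blast
qed

end
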